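(* Fix a nonnegative integer $b$ and a rational number $c\in(b,\infty)$. Let $m=m(N)$ satisfy $m(N)\to\infty$ and $m(N)^2/N\to0$ as $N\to\infty$. The following hold for any $\varepsilon>0$. (a) The quantity $x^\star=\inf\{R(\theta|\rho_{b,\alpha_b(c)}):\theta\in[\widehat B_\pi(\rho_{b,\alpha_b(c)},\varepsilon)]^c\}$ is strictly positive. (b) For any number $y\in(0,x^\star)$ and all sufficiently large $N$, $$P_{N,b,m}\big(\Theta_{N,b}\in[B_\pi(\rho_{b,\alpha_b(c)},\varepsilon)]^c\big)\le\exp[-Ny].$$ Consequently $$\lim_{N\to\infty}P_{N,b,m}(\Theta_{N,b}\in B_\pi(\rho_{b,\alpha_b(c)},\varepsilon))=1\quad\text{and}\quad\lim_{\varepsilon\to0}\lim_{N\to\infty}P_{N,b,m}(\Theta_{N,b}\in B_\pi(\rho_{b,\alpha_b(c)},\varepsilon))=1 .$$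
   Context: Notation: $\mathbb N_b=\{n\in\mathbb Z:n\ge b\}$. $N$ ranges only over integers $N\ge2$ for which $K:=cN$ is an integer, and limits $N\to\infty$ are along such $N$. $m=m(N)$ is an integer with $2\le m(N)\le N$. Model: $\Lambda_N=\{1,\dots,N\}$ and $\Omega_N=\Lambda_N^K$ is the set of $\omega=(\omega_1,\dots,\omega_K)$. For $\ell\in\Lambda_N$, $K_\ell(\omega)=\mathrm{card}\{i:\omega_i=\ell\}$; for integers $j\ge0$, $N_j(\omega)=\mathrm{card}\{\ell\in\Lambda_N:K_\ell(\omega)=j\}$; $|N(\omega)|_+=\mathrm{card}\{j\in\mathbb N_b:N_j(\omega)\ge1\}$. Set $\Omega_{N,b,m}=\{\omega\in\Omega_N:K_\ell(\omega)\ge b\ \forall\ell\in\Lambda_N,\ |N(\omega)|_+\le m(N)\}$, and let $P_{N,b,m}$ be the uniform probability measure on $\Omega_{N,b,m}$. The number-density measure $\Theta_{N,b}(\omega)$, $\omega\in\Omega_{N,b,m}$, is the probability measure on $\mathbb N_b$ giving mass $N_j(\omega)/N$ to each $j\in\mathbb N_b$; it has mean $c$. Spaces: $\mathcal P_{\mathbb N_b}$ is the set of probability measures on $\mathbb N_b$ with the topology of weak convergence, metrized by the Prohorov metric $\pi$ (built from $d(x,y)=|x-y|$ on $\mathbb N_b$); $\mathcal P_{\mathbb N_b,c}$ is the subset of measures with mean $c$; $\mathcal P_{\mathbb N_b,[b,c]}$ is the subset of measures with mean in $[b,c]$. $B_\pi(\rho,\varepsilon)=\{\nu\in\mathcal P_{\mathbb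 N_b,c}:\pi(\rho,\nu)<\varepsilon\}$ and $[B_\pi(\rho,\varepsilon)]^c$ is its complement in $\mathcal P_{\mathbb N_b,c}$; $\widehat B_\pi(\rho,\varepsilon)=\{\nu\in\mathcal P_{\mathbb N_b,[b,c]}:\pi(\rho,\nu)<\varepsilon\}$ and $[\widehat B_\pi(\rho,\varepsilon)]^c$ is its complement in $\mathcal P_{\mathbb N_b,[b,c]}$. For $\alpha>0$, $\rho_{b,\alpha}$ is the probability measure on $\mathbb N_b$ with $\rho_{b,\alpha;j}=\frac{1}{Z_b(\alpha)}\frac{\alpha^j}{j!}$, where $Z_0(\alpha)=e^\alpha$ and $Z_b(\alpha)=e^\alpha-\sum_{j=0}^{b-1}\alpha^j/j!$ for $b\ge1$. $\alpha_b(c)$ is the unique $\alpha\in(0,\infty)$ for which $\rho_{b,\alpha}$ has mean $c$. Relative entropy: $R(\theta|\rho)=\sum_{j\in\mathbb N_b}\theta_j\log(\theta_j/\rho_j)$ with $0\log0=0$; $\inf\emptyset=+\infty$. *)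

theory Defs
  imports "HOL-Probability.Probability"
begin

(* A probability measure on {n. n \<ge> b} is a nat pmf whose support lies in {b..}.  The
   mean condition includes integrability, because the library expectation of a
   non-integrable function is 0. *)
definition has_mean :: "nat pmf \<Rightarrow> real \<Rightarrow> bool" where
  "has_mean \<theta> x \<longleftrightarrow>
     integrable (measure_pmf \<theta>) real \<and> measure_pmf.expectation \<theta> real = x"

definition prob_on :: "nat \<Rightarrow> nat pmf set" where
  "prob_on b = {\<theta>. set_pmf \<theta> \<subseteq> {b..}}"

definition prob_mean :: "nat \<Rightarrow> real \<Rightarrow> nat pmf set" where
  "prob_mean b c = {\<theta> \<in> prob_on b. has_mean \<theta> c}"

definition prob_mean_upto :: "nat \<Rightarrow> real \<Rightarrow> nat pmf set" where
  "prob_mean_upto b c = {\<theta> \<in> prob_on b. \<exists>x\<in>{real b..c}. has_mean \<theta> x}"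

(* The Prohorov metric compares measures on the closed subsets of {b..}; since the distance
   between distinct integers is at least 1, every subset is closed. *)
definition prohorov :: "nat \<Rightarrow> nat pmf \<Rightarrow> nat pmf \<Rightarrow> real" where
  "prohorov b \<mu> \<nu> = Inf {e. 0 < e \<and>
     (\<forall>F \<subseteq> {b..}.
        measure_pmf.prob \<mu> F
          \<le> measure_pmf.prob \<nu> {y \<in> {b..}. \<exists>x\<in>F. \<bar>real x - real y\<bar> < e} + e)}"

definition prohorov_ball :: "nat \<Rightarrow> real \<Rightarrow> nat pmf \<Rightarrow> real \<Rightarrow> nat pmf set" where
  "prohorov_ball b c \<rho> \<epsilon> = {\<nu> \<in> prob_mean b c. prohorov b \<rho> \<nu> < \<epsilon>}"

definition prohorov_ball_hat :: "nat \<Rightarrow> real \<Rightarrow> nat pmf \<Rightarrow> real \<Rightarrow> nat pmf set" where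
  "prohorov_ball_hat b c \<rho> \<epsilon> = {\<nu> \<in> prob_mean_upto b c. prohorov b \<rho> \<nu> < \<epsilon>}"

definition Zb :: "nat \<Rightarrow> real \<Rightarrow> real" where
  "Zb b \<alpha> = exp \<alpha> - (\<Sum>j<b. \<alpha> ^ j / fact j)"

definition rho :: "nat \<Rightarrow> real \<Rightarrow> nat pmf" where
  "rho b \<alpha> = embed_pmf (\<lambda>j. if b \<le> j then 1 / Zb b \<alpha> * (\<alpha> ^ j / fact j) else 0)"

definition alpha :: "nat \<Rightarrow> real \<Rightarrow> real" where
  "alpha b c = (THE \<alpha>. 0 < \<alpha> \<and> has_mean (rho b \<alpha>) c)"

(* The negative parts of the terms are always summable (t * ln (t / r) \<ge> t - r), so if the
   series is not (absolutely) summable it diverges to \<infinity>. The support condition is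
   the usual convention \<theta> * ln (\<theta> / 0) = \<infinity> for \<theta> > 0; it is automatic
   when \<rho> is positive on {b..}. *)
definition rel_entropy :: "nat \<Rightarrow> nat pmf \<Rightarrow> nat pmf \<Rightarrow> ereal" where
  "rel_entropy b \<theta> \<rho> =
     (if set_pmf \<theta> \<subseteq> set_pmf \<rho> \<and>
         (\<lambda>j. pmf \<theta> j * ln (pmf \<theta> j / pmf \<rho> j)) summable_on {b..}
      then ereal (\<Sum>\<^sub>\<infinity>j\<in>{b..}. pmf \<theta> j * ln (pmf \<theta> j / pmf \<rho> j))
      else \<infinity>)"

definition x_star :: "nat \<Rightarrow> real \<Rightarrow> real \<Rightarrow> ereal" where
  "x_star b c \<epsilon> =
     (INF \<theta> \<in> prob_mean_upto b c - prohorov_ball_hat b c (rho b (alpha b c)) \<epsilon>.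
        rel_entropy b \<theta> (rho b (alpha b c)))"

definition admissible :: "real \<Rightarrow> nat set" where
  "admissible c = {N. 2 \<le> N \<and> c * real N \<in> \<int>}"

definition to_infinity :: "real \<Rightarrow> nat filter" where
  "to_infinity c = inf at_top (principal (admissible c))"

(* K = c * N; the floor only serves as a coercion, since c * N is an integer for admissible N. *)
definition particles :: "real \<Rightarrow> nat \<Rightarrow> nat" where
  "particles c N = nat \<lfloor>c * real N\<rfloor>"

definition configs :: "real \<Rightarrow> nat \<Rightarrow> (nat \<Rightarrow> nat) set" where
  "configs c N = {1..particles c N} \<rightarrow>\<^sub>E {1..N}"

definition occ :: "real \<Rightarrow> nat \<Rightarrow> (nat \<Rightarrow> nat) \<Rightarrow> nat \<Rightarrow> nat" where
  "occ c N \<omega> l = card {i \<in> {1..particles c N}. \<omega> i = l}"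

definition num_sites :: "real \<Rightarrow> nat \<Rightarrow> (nat \<Rightarrow> nat) \<Rightarrow> nat \<Rightarrow> nat" where
  "num_sites c N \<omega> j = card {l \<in> {1..N}. occ c N \<omega> l = j}"

definition num_classes :: "nat \<Rightarrow> real \<Rightarrow> nat \<Rightarrow> (nat \<Rightarrow> nat) \<Rightarrow> nat" where
  "num_classes b c N \<omega> = card {j. b \<le> j \<and> 1 \<le> num_sites c N \<omega> j}"

definition restricted_configs :: "nat \<Rightarrow> real \<Rightarrow> (nat \<Rightarrow> nat) \<Rightarrow> nat \<Rightarrow> (nat \<Rightarrow> nat) set" where
  "restricted_configs b c m N =
     {\<omega> \<in> configs c N. (\<forall>l\<in>{1..N}. b \<le> occ c N \<omega> l) \<and> num_classes b c N \<omega> \<le> m N}"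

definition unif :: "nat \<Rightarrow> real \<Rightarrow> (nat \<Rightarrow> nat) \<Rightarrow> nat \<Rightarrow> (nat \<Rightarrow> nat) pmf" where
  "unif b c m N = pmf_of_set (restricted_configs b c m N)"

definition Theta :: "nat \<Rightarrow> real \<Rightarrow> nat \<Rightarrow> (nat \<Rightarrow> nat) \<Rightarrow> nat pmf" where
  "Theta b c N \<omega> = embed_pmf (\<lambda>j. if b \<le> j then real (num_sites c N \<omega> j) / real N else 0)"

(* pmf_of_set and embed_pmf are unspecified for an empty set or for weights that do not sum
   to 1; the lemmas below show that this does not happen here. *)

lemma Zb_sums:
  "(\<lambda>j. if b \<le> j then \<alpha> ^ j / fact j else 0) sums Zb b \<alpha>"
proof -
  have "(\<lambda>j. \<alpha> ^ j / fact j) sums exp \<alpha>"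
    using exp_converges[of \<alpha>] by (simp add: divide_inverse mult.commute)
  moreover have "(\<lambda>j. if j \<in> {..<b} then \<alpha> ^ j / fact j else 0)
      sums (\<Sum>j<b. \<alpha> ^ j / fact j)"
    by (rule sums_If_finite_set) simp
  ultimately have "(\<lambda>j. \<alpha> ^ j / fact j - (if j \<in> {..<b} then \<alpha> ^ j / fact j else 0))
      sums Zb b \<alpha>"
    unfolding Zb_def by (rule sums_diff)
  moreover have "(\<lambda>j. \<alpha> ^ j / fact j - (if j \<in> {..<b} then \<alpha> ^ j / fact j else 0))
      = (\<lambda>j. if b \<le> j then \<alpha> ^ j / fact j else 0)"
    by auto
  ultimately show ?thesis by simp
qed

lemma Zb_pos:
  assumes "0 < \<alpha>"
  shows "0 < Zb b \<alpha>"
proof -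
  let ?f = "\<lambda>j. if b \<le> j then \<alpha> ^ j / fact j else 0"
  have "0 < suminf ?f"
    using sums_summable[OF Zb_sums] assms by (intro suminf_pos2[of _ b]) auto
  then show ?thesis using sums_unique[OF Zb_sums, of b \<alpha>] by simp
qed

lemma pmf_rho:
  assumes "0 < \<alpha>"
  shows "pmf (rho b \<alpha>) j = (if b \<le> j then 1 / Zb b \<alpha> * (\<alpha> ^ j / fact j) else 0)"
  unfolding rho_def
proof (rule pmf_embed_pmf)
  let ?f = "\<lambda>j. if b \<le> j then 1 / Zb b \<alpha> * (\<alpha> ^ j / fact j) else 0"
  show nn: "0 \<le> ?f j" for j
    using Zb_pos[OF assms, of b] assms by simp
  have "(\<lambda>j. 1 / Zb b \<alpha> * (if b \<le> j then \<alpha> ^ j / fact j else 0))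
      sums (1 / Zb b \<alpha> * Zb b \<alpha>)"
    by (intro sums_mult Zb_sums)
  moreover have "(\<lambda>j. 1 / Zb b \<alpha> * (if b \<le> j then \<alpha> ^ j / fact j else 0)) = ?f"
    by auto
  ultimately have s: "?f sums 1"
    using Zb_pos[OF assms, of b] by simp
  show "(\<integral>\<^sup>+ j. ennreal (?f j) \<partial>count_space UNIV) = 1"
    unfolding nn_integral_count_space_nat
    using suminf_ennreal2[OF nn sums_summable[OF s]] sums_unique[OF s] by simp
qed

lemma pmf_Theta:
  assumes "2 \<le> N" "\<omega> \<in> restricted_configs b c m N"
  shows "pmf (Theta b c N \<omega>) j = (if b \<le> j then real (num_sites c N \<omega> j) / real N else 0)"
  unfolding Theta_def
proof (rule pmf_embed_pmf)
  let ?f = "\<lambda>j. if b \<le> j then real (num_sites c N \<omega> j) / real N else 0"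
  show nn: "0 \<le> ?f j" for j by simp
  let ?J = "occ c N \<omega> ` {1..N}"
  have ge: "b \<le> occ c N \<omega> l" if "l \<in> {1..N}" for l
    using assms that by (auto simp: restricted_configs_def)
  have z: "num_sites c N \<omega> j = 0" if "j \<notin> ?J" for j
    using that by (auto simp: num_sites_def)
  have "(\<Sum>j\<in>?J. num_sites c N \<omega> j) = card {1..N}"
    unfolding num_sites_def card_eq_sum
    by (rule sum.image_gen[symmetric]) simp
  then have tot: "(\<Sum>j\<in>?J. real (num_sites c N \<omega> j)) = real N"
    by (metis card_atLeastAtMost diff_Suc_1 of_nat_sum)
  have "?f sums (\<Sum>j\<in>?J. ?f j)"
    by (rule sums_finite) (auto simp: z)
  also have "(\<Sum>j\<in>?J. ?f j) = (\<Sum>j\<in>?J. real (num_sites c N \<omega> j) / real N)"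
    using ge by (intro sum.cong) auto
  also have "\<dots> = 1"
    using tot assms by (simp flip: sum_divide_distrib)
  finally have s: "?f sums 1" .
  show "(\<integral>\<^sup>+ j. ennreal (?f j) \<partial>count_space UNIV) = 1"
    unfolding nn_integral_count_space_nat
    using suminf_ennreal2[OF nn sums_summable[OF s]] sums_unique[OF s] by simp
qed

end

theory Submission
  imports Defs "HOL-Real_Asymp.Real_Asymp"
begin

text \<open>For every \<open>\<alpha> > 0\<close>, the number of configurations with occupation numbers \<open>k\<close> is
  \<open>K! Z\<^sup>N / \<alpha>\<^sup>K\<close> times the probability of \<open>k\<close> under independent \<open>rho b \<alpha>\<close>-distributed sites.  Hence the
  configurations with number-density measure \<open>\<theta>\<close> number at most
  \<open>K! Z\<^sup>N / \<alpha>\<^sup>K \<cdot> exp (- N R(\<theta>|\<rho>))\<close>, and there are at most \<open>((K + 1) (N + 1))\<^sup>m = exp (o(N))\<close> such measures,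
  because \<open>m\<^sup>2 / N \<rightarrow> 0\<close>.  The normalising constant is bounded below by
  \<open>K! Z\<^sup>N / \<alpha>\<^sup>K \<cdot> exp (- N \<eta>)\<close> for every \<open>\<eta> > 0\<close>: it suffices to count the configurations of one type,
  obtained by rounding a law on a fixed interval \<open>{b..M}\<close> with mean \<open>c\<close> and entropy below \<open>\<eta>\<close>.\<close>

section \<open>The parameter of the equilibrium law\<close>

text \<open>The counting identity holds for every \<alpha>; the value \<open>alpha b c\<close> is
  chosen for the normalising constant, since a law of mean \<open>c\<close> on \<open>{b..M}\<close>
  can have small entropy relative to \<open>rho b \<alpha>\<close> once
  \<open>rho b \<alpha>\<close> has mean \<open>c\<close> itself. The obstacle there is integrality:
  a type needs exactly N sites and exactly K particles, and rounding spoils both equations. Measured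
  by the excess j - b, class \<open>b\<close> contributes nothing and class \<open>b + 1\<close> one
  unit per site, so the count at \<open>b + 1\<close> repairs the particle number and the count at
  \<open>b\<close> then repairs the site number. Since \<open>M\<close> is fixed, m(N) -> infinity
  makes this type admissible. The upper bound needs no Stirling estimate: inside a type class a
  change of measure from \<rho> to \<theta> produces the entropy factor, and a total probability is
  at most 1. The hypothesis on m enters through m = o(sqrt N), as the logarithm of the number of
  types is m times O(log N). Positivity of the rate comes from an explicit bound \<epsilon>^2 / 16,
  which replaces any argument by compactness and semicontinuity.\<close>

lemma has_mean_iff_sums: "has_mean \<theta> x \<longleftrightarrow> (\<lambda>j. pmf \<theta> j * real j) sums x"
proof -
  have int: "integrable (measure_pmf \<theta>) real \<longleftrightarrow> summable (\<lambda>j. pmf \<theta> j * real j)"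
    by (simp add: measure_pmf_eq_density integrable_density integrable_count_space_nat_iff abs_mult)
  have "(\<lambda>j. pmf \<theta> j * real j) sums measure_pmf.expectation \<theta> real"
    if "integrable (measure_pmf \<theta>) real"
  proof -
    have "integrable (count_space UNIV) (\<lambda>j. pmf \<theta> j * real j)"
      using that by (simp add: measure_pmf_eq_density integrable_density)
    then show ?thesis
      using sums_integral_count_space_nat[of "\<lambda>j. pmf \<theta> j * real j"]
      by (simp add: measure_pmf_eq_density integral_density)
  qed
  then show ?thesis
    unfolding has_mean_def using int sums_summable sums_unique2 by blast
qed

lemma pmf_nat_sums: "pmf (\<theta> :: nat pmf) sums 1"
proof -
  have "integrable (count_space UNIV) (pmf \<theta>)" by (rule integrable_pmf)
  from sums_integral_count_space_nat[OF this] show ?thesis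
    by (simp add: integral_pmf)
qed

lemma Zb_ge_first_term:
  assumes "0 < \<alpha>" shows "\<alpha> ^ b / fact b \<le> Zb b \<alpha>"
proof -
  have "Zb b \<alpha> = \<alpha> ^ b / fact b + Zb (Suc b) \<alpha>" by (simp add: Zb_def)
  then show ?thesis using Zb_pos[OF assms, of "Suc b"] by simp
qed

text \<open>Because j \<alpha>^j / j! = \<alpha> \<alpha>^(j-1) / (j-1)!, shifting the index turns
  the terms j > b into \<alpha> \<open>Zb b \<alpha>\<close>; the other summand is the term j =
  b.\<close>

lemma first_moment_sums:
  "(\<lambda>j. if b \<le> j then real j * (\<alpha> ^ j / fact j) else 0)
     sums (\<alpha> * Zb b \<alpha> + real b * (\<alpha> ^ b / fact b))"
proof -
  let ?g = "\<lambda>j. if b \<le> j then real j * (\<alpha> ^ j / fact j) else 0"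
  have "(\<lambda>j. \<alpha> * (if b \<le> j then \<alpha> ^ j / fact j else 0)
           + (if Suc j = b then real b * (\<alpha> ^ b / fact b) else 0))
        sums (\<alpha> * Zb b \<alpha> + (if b = 0 then 0 else real b * (\<alpha> ^ b / fact b)))"
  proof (intro sums_add sums_mult Zb_sums)
    show "(\<lambda>j. if Suc j = b then real b * (\<alpha> ^ b / fact b) else 0) sums
          (if b = 0 then 0 else real b * (\<alpha> ^ b / fact b))"
    proof (cases b)
      case (Suc b')
      then show ?thesis
        using sums_single[of b' "\<lambda>_. real b * (\<alpha> ^ b / fact b)"] by simp
    qed simp
  qed
  moreover have "(\<lambda>j. \<alpha> * (if b \<le> j then \<alpha> ^ j / fact j else 0)
           + (if Suc j = b then real b * (\<alpha> ^ b / fact b) else 0)) = (\<lambda>j. ?g (Suc j))"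
    by (auto simp: fun_eq_iff fact_Suc mult.assoc simp del: of_nat_Suc)
  ultimately have "(\<lambda>j. ?g (Suc j)) sums (\<alpha> * Zb b \<alpha> + real b * (\<alpha> ^ b / fact b))"
    by (auto split: if_splits)
  then show ?thesis by (subst (asm) sums_Suc_iff) (cases "b = 0", simp_all)
qed

lemma rho_mean_sums:
  assumes "0 < \<alpha>"
  shows "(\<lambda>j. pmf (rho b \<alpha>) j * real j) sums ((\<alpha> * Zb b \<alpha> + real b * (\<alpha> ^ b / fact b)) / Zb b \<alpha>)"
proof -
  have "(\<lambda>j. pmf (rho b \<alpha>) j * real j)
      = (\<lambda>j. (if b \<le> j then real j * (\<alpha> ^ j / fact j) else 0) / Zb b \<alpha>)"
    by (auto simp: pmf_rho[OF assms] fun_eq_iff mult.commute)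
  then show ?thesis using sums_divide[OF first_moment_sums] by simp
qed

lemma rho_mean_exists:
  assumes "real b < c"
  obtains \<alpha> where "0 < \<alpha>" "has_mean (rho b \<alpha>) c"
proof -
  \<comment> \<open>This is \<open>Zb b \<alpha>\<close> times (mean of
    \<open>rho b \<alpha>\<close> minus \<open>c\<close>). Clearing the denominator leaves an
    evidently continuous function whose positive zeros are the parameters sought.\<close>
  define h where "h = (\<lambda>\<alpha>. (\<alpha> - c) * Zb b \<alpha> + real b * (\<alpha> ^ b / fact b))"
  \<comment> \<open>Any point of (0, c - b) would serve as left end. The point 0 would not: for b >=
    1 \<open>h\<close> already vanishes there.\<close>
  define a where "a = (c - real b) / 2"
  have a: "0 < a" "a < c" "a + b < c" using assms by (auto simp: a_def field_simps)
  have "h a \<le> (a - c) * (a ^ b / fact b) + real b * (a ^ b / fact b)"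
    unfolding h_def using a Zb_ge_first_term[OF a(1), of b]
    by (intro add_mono order_refl mult_left_mono_neg) auto
  also have "\<dots> = (a + b - c) * (a ^ b / fact b)" by (simp only: distrib_right left_diff_distrib)
  also have "\<dots> \<le> 0" using a by (intro mult_nonpos_nonneg) auto
  finally have "h a \<le> 0" .
  moreover have "0 \<le> h c" using assms by (simp add: h_def)
  moreover have "continuous_on {a..c} h"
    unfolding h_def Zb_def by (intro continuous_intros) auto
  ultimately obtain \<alpha> where \<alpha>: "a \<le> \<alpha>" "h \<alpha> = 0"
    using IVT'[of h a 0 c] a by auto
  have "0 < \<alpha>" using a \<alpha> by simp
  moreover have "\<alpha> * Zb b \<alpha> + real b * (\<alpha> ^ b / fact b) = c * Zb b \<alpha>"
    using \<alpha>(2) by (simp add: h_def algebra_simps)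
  ultimately have "(\<lambda>j. pmf (rho b \<alpha>) j * real j) sums c"
    using rho_mean_sums[of \<alpha> b] Zb_pos[of \<alpha> b] by simp
  then show thesis using that \<open>0 < \<alpha>\<close> by (auto simp: has_mean_iff_sums)
qed

text \<open>The two entropies between members of the family add up to
  \<open>(ln \<beta> - ln \<alpha>)\<close> times the difference of the means.\<close>

lemma rho_mean_inj:
  assumes "0 < \<alpha>" "0 < \<beta>" "has_mean (rho b \<alpha>) c" "has_mean (rho b \<beta>) c"
  shows "\<alpha> = \<beta>"
proof -
  let ?p = "pmf (rho b \<alpha>)" and ?q = "pmf (rho b \<beta>)"
  let ?d = "\<lambda>j. (?q j - ?p j) * (ln (?q j) - ln (?p j))"
  define t where "t = ln (Zb b \<alpha>) - ln (Zb b \<beta>)"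
  have lns: "ln (?p j) = real j * ln \<alpha> - ln (Zb b \<alpha>) - ln (fact j)"
    "ln (?q j) = real j * ln \<beta> - ln (Zb b \<beta>) - ln (fact j)" if "b \<le> j" for j
    using that assms(1,2) Zb_pos[of \<alpha> b] Zb_pos[of \<beta> b]
    by (simp_all add: pmf_rho ln_div ln_mult ln_realpow)
  have eq: "?d j = (ln \<beta> - ln \<alpha>) * (?q j * real j - ?p j * real j) + t * (?q j - ?p j)" for j
  proof (cases "b \<le> j")
    case True
    then show ?thesis by (simp add: lns t_def) (simp add: algebra_simps)
  qed (use assms(1,2) in \<open>simp add: pmf_rho\<close>)
  have "?d sums ((ln \<beta> - ln \<alpha>) * (c - c) + t * (1 - 1))"
    unfolding eq using assms(3,4)
    by (intro sums_add sums_mult sums_diff pmf_nat_sums) (auto simp: has_mean_iff_sums)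
  then have s: "?d sums 0" by simp
  have nn: "0 \<le> ?d j" for j
  proof (cases "b \<le> j")
    case True
    then have "0 < ?p j" "0 < ?q j"
      using assms(1,2) Zb_pos[of \<alpha> b] Zb_pos[of \<beta> b] by (simp_all add: pmf_rho)
    then show ?thesis
      by (cases "?p j \<le> ?q j") (auto intro!: mult_nonneg_nonneg mult_nonpos_nonpos)
  qed (use assms(1,2) in \<open>simp add: pmf_rho\<close>)
  have d0: "?d j = 0" for j
    using suminf_eq_zero_iff[OF sums_summable[OF s] nn] sums_unique[OF s] by simp
  then have eq': "?q j = ?p j" if "b \<le> j" for j
  proof -
    have "0 < ?p j" "0 < ?q j"
      using that assms(1,2) Zb_pos[of \<alpha> b] Zb_pos[of \<beta> b] by (simp_all add: pmf_rho)
    then show ?thesis using d0[of j] by auto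
  qed
  \<comment> \<open>The ratio of two neighbouring masses is free of the normalisation and so
    recovers the parameter from the law.\<close>
  have r: "?q (Suc b) / ?q b = \<beta> / Suc b" "?p (Suc b) / ?p b = \<alpha> / Suc b"
    using assms(1,2) Zb_pos[of \<alpha> b] Zb_pos[of \<beta> b] by (simp_all add: pmf_rho del: of_nat_Suc)
  have "\<beta> / Suc b = \<alpha> / Suc b"
    unfolding r[symmetric] by (simp only: eq' le_refl le_SucI)
  then show ?thesis by (simp del: of_nat_Suc)
qed

lemma alpha_props:
  assumes "real b < c"
  shows "0 < alpha b c" "has_mean (rho b (alpha b c)) c"
proof -
  obtain \<alpha> where "0 < \<alpha>" "has_mean (rho b \<alpha>) c" using rho_mean_exists[OF assms] .
  then have "\<exists>!\<alpha>. 0 < \<alpha> \<and> has_mean (rho b \<alpha>) c"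
    by (intro ex1I[of _ \<alpha>]) (simp, rule rho_mean_inj, simp_all)
  from theI'[OF this] have "0 < alpha b c \<and> has_mean (rho b (alpha b c)) c"
    unfolding alpha_def .
  then show "0 < alpha b c" "has_mean (rho b (alpha b c)) c" by auto
qed

section \<open>Relative entropy and the Prohorov metric\<close>

lemma pmf_has_sum_prob: "(pmf p has_sum measure_pmf.prob p A) A"
proof -
  have "(\<lambda>x. norm (pmf p x)) summable_on A"
    using pmf_abs_summable[of p A] by (simp only: abs_summable_equivalent)
  then show ?thesis
    using infsetsum_infsum[OF pmf_abs_summable, of p A]
    by (simp add: measure_pmf_conv_infsetsum has_sum_infsum)
qed

text \<open>Puts the mass of \<open>F\<close> on the larger index set, so that it can be added
  termwise to total masses and entropies summed over \<open>{b..}\<close>.\<close>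

lemma pmf_has_sum_prob_on:
  assumes "F \<subseteq> A"
  shows "((\<lambda>j. indicator F j * pmf p j) has_sum measure_pmf.prob p F) A"
proof -
  have "((\<lambda>j. indicator F j * pmf p j) has_sum measure_pmf.prob p F) A \<longleftrightarrow>
        (pmf p has_sum measure_pmf.prob p F) F"
    using assms by (intro has_sum_cong_neutral) auto
  then show ?thesis using pmf_has_sum_prob by simp
qed

lemma pmf_has_sum_1:
  assumes "set_pmf p \<subseteq> A"
  shows "(pmf p has_sum 1) A"
proof -
  have "measure_pmf.prob p A = 1"
    using assms by (subst measure_pmf.prob_eq_1) (auto simp: AE_measure_pmf_iff)
  then show ?thesis using pmf_has_sum_prob[of p A] by simp
qed

text \<open>Young's inequality for the conjugate pair \<open>t ln (t / r) - t\<close> and \<open>r exp a\<close>.\<close>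

lemma entropy_term_ge:
  fixes t r a :: real
  assumes "0 \<le> t" "0 \<le> r" "r = 0 \<Longrightarrow> t = 0"
  shows "t * (a + 1) - r * exp a \<le> t * ln (t / r)"
proof (cases "t = 0")
  case False
  then have pos: "0 < t" "0 < r" using assms less_eq_real_def by auto
  have "ln (r * exp a / t) \<le> r * exp a / t - 1"
    using pos by (intro ln_le_minus_one) auto
  also have "ln (r * exp a / t) = a - ln (t / r)"
    using pos by (simp add: ln_div ln_mult)
  finally have "t * (a - ln (t / r)) \<le> t * (r * exp a / t - 1)"
    using pos by (intro mult_left_mono) auto
  then show ?thesis using pos by (simp add: algebra_simps)
qed (use assms in simp)

text \<open>Uses the test function \<open>- x * indicator F\<close> in the
  variational formula for the entropy.\<close>

lemma rel_entropy_ge: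
  assumes \<theta>: "set_pmf \<theta> \<subseteq> {b..}" and \<rho>: "set_pmf \<rho> \<subseteq> {b..}"
    and F: "F \<subseteq> {b..}" and x: "0 \<le> x"
  shows "ereal (x * (measure_pmf.prob \<rho> F - measure_pmf.prob \<theta> F) - x\<^sup>2) \<le> rel_entropy b \<theta> \<rho>"
proof (cases "set_pmf \<theta> \<subseteq> set_pmf \<rho> \<and>
         (\<lambda>j. pmf \<theta> j * ln (pmf \<theta> j / pmf \<rho> j)) summable_on {b..}")
  case True
  let ?f = "\<lambda>j. pmf \<theta> j * ln (pmf \<theta> j / pmf \<rho> j)"
  let ?P = "measure_pmf.prob \<rho> F" and ?Q = "measure_pmf.prob \<theta> F"
  \<comment> \<open>The lower bound of \<open>entropy_term_ge\<close> with a = -x on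
    \<open>F\<close> and a = 0 elsewhere, expanded into four series with known sums.\<close>
  let ?g = "\<lambda>j. pmf \<theta> j + (- 1) * pmf \<rho> j + (- x) * (indicator F j * pmf \<theta> j)
                + (1 - exp (- x)) * (indicator F j * pmf \<rho> j)"
  \<comment> \<open>Makes the bound quadratic in \<open>x\<close>, so that it can be optimised
    explicitly.\<close>
  have "x - x\<^sup>2 \<le> 1 - exp (- x)"
  proof -
    have "exp (- x) \<le> 1 / (1 + x)"
      using exp_ge_add_one_self[of x] x by (simp add: exp_minus field_simps)
    also have "\<dots> \<le> 1 - x + x\<^sup>2"
      using x by (simp add: field_simps power2_eq_square)
    finally show ?thesis by simp
  qed
  then have "x * (?P - ?Q) - x\<^sup>2 \<le> - x * ?Q + (1 - exp (- x)) * ?P"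
    using mult_right_mono[of "x - x\<^sup>2" "1 - exp (- x)" ?P]
      mult_left_mono[of ?P 1 "x\<^sup>2"] by (simp add: algebra_simps)
  also have "\<dots> = 1 + (- 1) * 1 + (- x) * ?Q + (1 - exp (- x)) * ?P" by simp
  also have "\<dots> \<le> infsum ?f {b..}"
  proof (rule has_sum_mono)
    show "(?g has_sum (1 + (- 1) * 1 + (- x) * ?Q + (1 - exp (- x)) * ?P)) {b..}"
      using \<theta> \<rho> F
      by (intro has_sum_add has_sum_cmult_right pmf_has_sum_1 pmf_has_sum_prob_on)
    show "(?f has_sum infsum ?f {b..}) {b..}" using True by (simp add: has_sum_infsum)
    fix j
    have "pmf \<theta> j * ((if j \<in> F then - x else 0) + 1) - pmf \<rho> j * exp (if j \<in> F then - x else 0) \<le> ?f j"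
      using True by (intro entropy_term_ge) (auto simp: set_pmf_iff)
    then show "?g j \<le> ?f j" by (auto simp: indicator_def algebra_simps split: if_splits)
  qed
  finally show ?thesis using True by (simp add: rel_entropy_def)
next
  case False
  then show ?thesis unfolding rel_entropy_def by (simp only: if_False) simp
qed

text \<open>A number below the infimum must fail for some \<open>F\<close>. Halving \<epsilon> gives
  such a number even if \<epsilon> equals the infimum, and replacing the neighbourhood of
  \<open>F\<close> by \<open>F\<close> only lowers the mass under \<nu>.\<close>

lemma prohorov_ge_imp:
  assumes "0 < \<epsilon>" "\<epsilon> \<le> prohorov b \<mu> \<nu>"
  obtains F where "F \<subseteq> {b..}" "measure_pmf.prob \<nu> F + \<epsilon> / 2 < measure_pmf.prob \<mu> F"
proof -
  let ?nb = "\<lambda>F e. {y \<in> {b..}. \<exists>x\<in>F. \<bar>real x - real y\<bar> < e}"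
  let ?E = "{e. 0 < e \<and>
     (\<forall>F \<subseteq> {b..}. measure_pmf.prob \<mu> F \<le> measure_pmf.prob \<nu> (?nb F e) + e)}"
  have "\<epsilon> / 2 \<notin> ?E"
  proof
    assume "\<epsilon> / 2 \<in> ?E"
    moreover have "bdd_below ?E" by (rule bdd_belowI[of _ 0]) auto
    ultimately have "Inf ?E \<le> \<epsilon> / 2" by (intro cInf_lower)
    then show False using assms by (simp add: prohorov_def)
  qed
  then obtain F where F: "F \<subseteq> {b..}"
    "measure_pmf.prob \<nu> (?nb F (\<epsilon> / 2)) + \<epsilon> / 2 < measure_pmf.prob \<mu> F"
    using assms(1) by (auto simp: not_le)
  have "measure_pmf.prob \<nu> F \<le> measure_pmf.prob \<nu> (?nb F (\<epsilon> / 2))"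
    using F(1) assms(1)
    by (intro measure_pmf.finite_measure_mono) (auto intro!: bexI)
  with F that show thesis by fastforce
qed

lemma set_pmf_rho: "0 < \<alpha> \<Longrightarrow> set_pmf (rho b \<alpha>) = {b..}"
  using Zb_pos[of \<alpha> b] by (auto simp: set_pmf_iff pmf_rho split: if_splits)

text \<open>A bound of Pinsker type, uniform over the complement of the ball: some set
  \<open>F\<close> loses mass \<epsilon>/2, which costs a fixed amount of entropy.\<close>

lemma x_star_pos:
  assumes "0 < alpha b c" "0 < \<epsilon>"
  shows "0 < x_star b c \<epsilon>"
proof -
  have "ereal (\<epsilon>\<^sup>2 / 16) \<le> x_star b c \<epsilon>"
    unfolding x_star_def
  proof (rule INF_greatest)
    fix \<theta> assume "\<theta> \<in> prob_mean_upto b c - prohorov_ball_hat b c (rho b (alpha b c)) \<epsilon>"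
    then have \<theta>: "set_pmf \<theta> \<subseteq> {b..}" "\<epsilon> \<le> prohorov b (rho b (alpha b c)) \<theta>"
      by (auto simp: prohorov_ball_hat_def prob_mean_upto_def prob_on_def)
    obtain F where F: "F \<subseteq> {b..}"
      "measure_pmf.prob \<theta> F + \<epsilon> / 2 < measure_pmf.prob (rho b (alpha b c)) F"
      using prohorov_ge_imp[OF assms(2) \<theta>(2)] .
    \<comment> \<open>The factor \<epsilon>/4 maximises x \<epsilon>/2 - x^2.\<close>
    have "\<epsilon>\<^sup>2 / 16 = \<epsilon> / 4 * (\<epsilon> / 2) - (\<epsilon> / 4)\<^sup>2" by (simp add: power2_eq_square)
    also have "\<dots> \<le> \<epsilon> / 4 * (measure_pmf.prob (rho b (alpha b c)) F - measure_pmf.prob \<theta> F)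
        - (\<epsilon> / 4)\<^sup>2"
      using F(2) assms(2) by (intro diff_right_mono mult_left_mono) auto
    finally have "ereal (\<epsilon>\<^sup>2 / 16) \<le> ereal \<dots>" by simp
    also have "\<dots> \<le> rel_entropy b \<theta> (rho b (alpha b c))"
      using \<theta>(1) F(1) assms by (intro rel_entropy_ge) (auto simp: set_pmf_rho)
    finally show "ereal (\<epsilon>\<^sup>2 / 16) \<le> rel_entropy b \<theta> (rho b (alpha b c))" .
  qed
  moreover have "0 < ereal (\<epsilon>\<^sup>2 / 16)" using assms by simp
  ultimately show ?thesis by (rule less_le_trans[rotated])
qed

section \<open>Counting configurations\<close>

text \<open>Serves on two levels: particles mapped to sites with prescribed occupation numbers, and
  sites mapped to occupation numbers with prescribed class sizes.\<close>

definition fibre_funs :: "'a set \<Rightarrow> 'b set \<Rightarrow> ('b \<Rightarrow> nat) \<Rightarrow> ('a \<Rightarrow> 'b) set" where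
  "fibre_funs A B n = {f \<in> A \<rightarrow>\<^sub>E B. \<forall>y\<in>B. card {a \<in> A. f a = y} = n y}"

lemma finite_fibre_funs: "finite A \<Longrightarrow> finite B \<Longrightarrow> finite (fibre_funs A B n)"
  unfolding fibre_funs_def by (rule finite_subset[OF _ finite_PiE[of A "\<lambda>_. B"]]) auto

lemma card_fibre_update:
  assumes "finite A" "x \<notin> A"
  shows "card {a \<in> insert x A. (f(x := y)) a = z} = card {a \<in> A. f a = z} + (if y = z then 1 else 0)"
proof -
  have "{a \<in> insert x A. (f(x := y)) a = z} = {a \<in> A. f a = z} \<union> (if y = z then {x} else {})"
    using assms by auto
  also have "card \<dots> = card {a \<in> A. f a = z} + (if y = z then 1 else 0)"
    using assms by auto
  finally show ?thesis .
qed

text \<open>Classifies by the value \<open>y\<close> at the new point, which uses up one of the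
  \<open>n y\<close> preimages. The condition \<open>0 < n y\<close> keeps the natural subtraction
  honest.\<close>

lemma fibre_funs_insert:
  assumes "finite A" "x \<notin> A"
  shows "fibre_funs (insert x A) B n =
    (\<Union>y\<in>{y \<in> B. 0 < n y}. (\<lambda>f. f(x := y)) ` fibre_funs A B (n(y := n y - 1)))"
proof (intro equalityI subsetI)
  fix f assume f: "f \<in> fibre_funs (insert x A) B n"
  \<comment> \<open>Removing \<open>x\<close> must also reset the value there to
    \<open>undefined\<close>, as functions in \<open>PiE\<close> are extensional.\<close>
  define g where "g = f(x := undefined)"
  have fg: "f = g(x := f x)" by (simp add: g_def)
  have c: "card {a \<in> insert x A. f a = z} = card {a \<in> A. g a = z} + (if f x = z then 1 else 0)" for z
    by (subst fg, subst card_fibre_update[OF assms]) (rule refl)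
  have "f x \<in> B" using f by (auto simp: fibre_funs_def)
  moreover have "g \<in> A \<rightarrow>\<^sub>E B"
    using f assms by (auto simp: fibre_funs_def g_def PiE_iff extensional_def)
  moreover have n: "card {a \<in> A. g a = z} + (if f x = z then 1 else 0) = n z" if "z \<in> B" for z
    using f that unfolding c[symmetric] by (simp add: fibre_funs_def)
  moreover have "0 < n (f x)" using n[of "f x"] \<open>f x \<in> B\<close> by simp
  moreover have "card {a \<in> A. g a = z} = (n(f x := n (f x) - 1)) z" if "z \<in> B" for z
    using n[OF that] by auto
  ultimately have "f x \<in> {y \<in> B. 0 < n y}" "g \<in> fibre_funs A B (n(f x := n (f x) - 1))"
    unfolding fibre_funs_def by blast+
  then show "f \<in> (\<Union>y\<in>{y \<in> B. 0 < n y}. (\<lambda>f. f(x := y)) ` fibre_funs A B (n(y := n y - 1)))"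
    using fg by blast
next
  fix f assume "f \<in> (\<Union>y\<in>{y \<in> B. 0 < n y}. (\<lambda>f. f(x := y)) ` fibre_funs A B (n(y := n y - 1)))"
  then obtain y g where y: "y \<in> B" "0 < n y" and f: "f = g(x := y)"
    and g: "g \<in> fibre_funs A B (n(y := n y - 1))" by blast
  have "f \<in> insert x A \<rightarrow>\<^sub>E B"
    using g y unfolding f fibre_funs_def by (auto simp: PiE_iff extensional_def)
  moreover have "card {a \<in> insert x A. f a = z} = n z" if "z \<in> B" for z
    using g y that unfolding f card_fibre_update[OF assms] fibre_funs_def by auto
  ultimately show "f \<in> fibre_funs (insert x A) B n" by (simp add: fibre_funs_def)
qed

text \<open>The multinomial coefficient, kept free of division. In the induction step the choice
  \<open>y\<close> contributes \<open>n y * fact (card A)\<close>, and the numbers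
  \<open>n y\<close> add up to card A + 1.\<close>

lemma card_fibre_funs:
  assumes "finite A" "finite B" "sum n B = card A"
  shows "card (fibre_funs A B n) * (\<Prod>y\<in>B. fact (n y)) = fact (card A)"
  using assms(1,3)
proof (induction A arbitrary: n rule: finite_induct)
  case empty
  then have n: "\<forall>y\<in>B. n y = 0" using assms(2) by simp
  then have "(\<Prod>y\<in>B. fact (n y)) = (1 :: nat)" by (intro prod.neutral) simp
  then show ?case using n by (simp add: fibre_funs_def)
next
  case (insert x A)
  let ?B = "{y \<in> B. 0 < n y}"
  let ?n = "\<lambda>y. n(y := n y - 1)"
  have inj: "inj_on (\<lambda>f. f(x := y)) (fibre_funs A B (?n y))" for y
  proof (rule inj_onI)
    fix f g assume f: "f \<in> fibre_funs A B (?n y)" and g: "g \<in> fibre_funs A B (?n y)"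
      and e: "f(x := y) = g(x := y)"
    have "f z = g z" for z
    proof (cases "z = x")
      case True
      then show ?thesis using f g insert.hyps by (simp add: fibre_funs_def PiE_iff extensional_def)
    qed (use fun_cong[OF e, of z] in simp)
    then show "f = g" by blast
  qed
  have IH: "card (fibre_funs A B (?n y)) * (\<Prod>z\<in>B. fact (n z)) = n y * fact (card A)"
    if "y \<in> ?B" for y
  proof -
    have y: "y \<in> B" "0 < n y" using that by auto
    have s: "n y + sum n (B - {y}) = Suc (card A)"
      using insert.prems insert.hyps sum.remove[OF assms(2) y(1), of n] by simp
    have "sum (?n y) B = (n y - 1) + sum n (B - {y})"
      using sum.remove[OF assms(2) y(1), of "?n y"] by simp
    then have "sum (?n y) B = card A" using s y by simp
    note IH = insert.IH[OF this]
    have "(\<Prod>z\<in>B. fact (n z)) = fact (n y) * (\<Prod>z\<in>B - {y}. fact (n z) :: nat)"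
      by (rule prod.remove[OF assms(2) y(1)])
    \<comment> \<open>Only the factorial at \<open>y\<close> differs between \<open>n\<close> and
      the reduced counts, by the factor \<open>n y\<close>.\<close>
    also have "\<dots> = n y * (fact (n y - 1) * (\<Prod>z\<in>B - {y}. fact (n z)))"
      using y by (simp add: fact_reduce)
    also have "fact (n y - 1) * (\<Prod>z\<in>B - {y}. fact (n z)) = (\<Prod>z\<in>B. fact (?n y z) :: nat)"
      using prod.remove[OF assms(2) y(1), of "\<lambda>z. fact (?n y z) :: nat"] by simp
    finally show ?thesis using IH by (metis mult.left_commute)
  qed
  have "card (fibre_funs (insert x A) B n) = (\<Sum>y\<in>?B. card ((\<lambda>f. f(x := y)) ` fibre_funs A B (?n y)))"
    unfolding fibre_funs_insert[OF insert.hyps(1,2)]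
    using assms insert.hyps
    by (intro card_UN_disjoint) (auto simp: finite_fibre_funs dest!: fun_cong[of _ _ x])
  also have "\<dots> = (\<Sum>y\<in>?B. card (fibre_funs A B (?n y)))"
    by (intro sum.cong refl card_image inj)
  finally have "card (fibre_funs (insert x A) B n) * (\<Prod>z\<in>B. fact (n z)) = (\<Sum>y\<in>?B. n y * fact (card A))"
    using IH by (simp add: sum_distrib_right)
  also have "\<dots> = (\<Sum>y\<in>B. n y) * fact (card A)"
    unfolding sum_distrib_right using assms(2) by (intro sum.mono_neutral_left) auto
  also have "\<dots> = fact (card (insert x A))"
    using insert by simp
  finally show ?case .
qed

lemma fibre_funs_prod:
  fixes f :: "'b \<Rightarrow> 'c :: comm_monoid_mult"
  assumes "finite A" "finite B" "k \<in> fibre_funs A B n"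
  shows "(\<Prod>a\<in>A. f (k a)) = (\<Prod>y\<in>B. f y ^ n y)"
proof -
  have "(\<Prod>a\<in>A. f (k a)) = (\<Prod>y\<in>B. \<Prod>a\<in>{a \<in> A. k a = y}. f (k a))"
    using assms by (intro prod.group[symmetric]) (auto simp: fibre_funs_def)
  also have "\<dots> = (\<Prod>y\<in>B. f y ^ n y)"
    using assms by (intro prod.cong refl) (simp add: fibre_funs_def)
  finally show ?thesis .
qed

lemma fibre_funs_sum:
  fixes f :: "'b \<Rightarrow> nat"
  assumes "finite A" "finite B" "k \<in> fibre_funs A B n"
  shows "(\<Sum>a\<in>A. f (k a)) = (\<Sum>y\<in>B. n y * f y)"
proof -
  have "(\<Sum>a\<in>A. f (k a)) = (\<Sum>y\<in>B. \<Sum>a\<in>{a \<in> A. k a = y}. f (k a))"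
    using assms by (intro sum.group[symmetric]) (auto simp: fibre_funs_def)
  also have "\<dots> = (\<Sum>y\<in>B. n y * f y)"
    using assms by (intro sum.cong refl) (simp add: fibre_funs_def)
  finally show ?thesis .
qed

section \<open>Configurations with given occupation numbers\<close>

lemma configs_with_occ:
  "fibre_funs {1..particles c N} {1..N} k = {\<omega> \<in> configs c N. \<forall>l\<in>{1..N}. occ c N \<omega> l = k l}"
  by (simp add: fibre_funs_def configs_def occ_def)

lemma sum_occ:
  assumes "\<omega> \<in> configs c N"
  shows "(\<Sum>l\<in>{1..N}. occ c N \<omega> l) = particles c N"
proof -
  have "\<omega> \<in> fibre_funs {1..particles c N} {1..N} (occ c N \<omega>)"
    using assms unfolding configs_with_occ by blast
  from fibre_funs_sum[OF _ _ this, of "\<lambda>_. 1"] show ?thesis by simp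
qed

text \<open>A common factor of the upper and the lower counting bounds; it cancels in the final
  quotient and is never estimated.\<close>

definition weight_const :: "nat \<Rightarrow> real \<Rightarrow> nat \<Rightarrow> nat \<Rightarrow> real" where
  "weight_const b \<alpha> N K = fact K * Zb b \<alpha> ^ N / \<alpha> ^ K"

lemma weight_const_pos: "0 < \<alpha> \<Longrightarrow> 0 < weight_const b \<alpha> N K"
  using Zb_pos[of \<alpha> b] by (simp add: weight_const_def)

text \<open>Conditioning independent \<open>rho b \<alpha>\<close>-distributed occupation numbers on their sum gives the
  uniform distribution on configurations, whatever \<open>\<alpha>\<close> is.\<close>

lemma card_configs_with_occ:
  assumes "0 < \<alpha>" "\<And>l. l \<in> {1..N} \<Longrightarrow> b \<le> k l" "(\<Sum>l\<in>{1..N}. k l) = K"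
  shows "real (card (fibre_funs {1..K} {1..N} k)) =
    weight_const b \<alpha> N K * (\<Prod>l\<in>{1..N}. pmf (rho b \<alpha>) (k l))"
proof -
  have "card (fibre_funs {1..K} {1..N} k) * (\<Prod>l\<in>{1..N}. fact (k l)) = fact K"
    using card_fibre_funs[of "{1..K}" "{1..N}" k] assms(3) by simp
  from arg_cong[OF this, of real]
  have cP: "real (card (fibre_funs {1..K} {1..N} k)) * (\<Prod>l\<in>{1..N}. fact (k l)) = fact K"
    by simp
  have "(\<Prod>l\<in>{1..N}. pmf (rho b \<alpha>) (k l)) =
      (\<Prod>l\<in>{1..N}. \<alpha> ^ k l / (Zb b \<alpha> * fact (k l)))"
    using assms by (intro prod.cong refl) (simp add: pmf_rho)
  then have Q: "(\<Prod>l\<in>{1..N}. pmf (rho b \<alpha>) (k l)) =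
      \<alpha> ^ K / (Zb b \<alpha> ^ N * (\<Prod>l\<in>{1..N}. fact (k l)))"
    using assms(3) by (simp add: prod_dividef prod.distrib flip: power_sum)
  have "(\<Prod>l\<in>{1..N}. fact (k l)) \<noteq> (0 :: real)"
    by simp
  from nonzero_eq_divide_eq[THEN iffD2, OF this cP]
  have "real (card (fibre_funs {1..K} {1..N} k)) = fact K / (\<Prod>l\<in>{1..N}. fact (k l))"
    .
  then show ?thesis
    unfolding Q weight_const_def using assms(1) Zb_pos[of \<alpha> b] by simp
qed

lemma finite_configs: "finite (configs c N)"
  by (simp add: configs_def finite_PiE)

lemma finite_restricted_configs: "finite (restricted_configs b c m N)"
  by (rule finite_subset[OF _ finite_configs[of c N]]) (auto simp: restricted_configs_def)

text \<open>A lower bound from one type \<open>n\<close>: the multinomial coefficient counts the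
  occupation vectors of this type, and each of them carries the same number of
  configurations.\<close>

lemma card_restricted_configs_ge:
  assumes "0 < \<alpha>" "sum n {b..M} = N" "(\<Sum>j\<in>{b..M}. n j * j) = particles c N"
    "card {b..M} \<le> m N"
  shows "weight_const b \<alpha> N (particles c N) * (fact N / (\<Prod>j\<in>{b..M}. fact (n j)) *
      (\<Prod>j\<in>{b..M}. pmf (rho b \<alpha>) j ^ n j)) \<le> real (card (restricted_configs b c m N))"
proof -
  let ?J = "{b..M}" and ?K = "particles c N"
  let ?V = "fibre_funs {1..N} ?J n"
  let ?C = "weight_const b \<alpha> N ?K"
  let ?p = "pmf (rho b \<alpha>)"
  have finV: "finite ?V" by (simp add: finite_fibre_funs)
  have "card ?V * (\<Prod>j\<in>?J. fact (n j)) = fact N"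
    using card_fibre_funs[of "{1..N}" ?J n] assms(2) by simp
  from arg_cong[OF this, of real] have "real (card ?V) * (\<Prod>j\<in>?J. fact (n j)) = fact N"
    by simp
  then have cardV: "real (card ?V) = fact N / (\<Prod>j\<in>?J. fact (n j))"
    by (simp add: field_simps)
  have "?C * (\<Prod>j\<in>?J. ?p j ^ n j) = real (card (fibre_funs {1..?K} {1..N} k))" if "k \<in> ?V" for k
  proof -
    have "(\<Sum>l\<in>{1..N}. k l) = ?K"
      using fibre_funs_sum[OF _ _ that, of "\<lambda>j. j"] assms(3) by simp
    moreover have "b \<le> k l" if "l \<in> {1..N}" for l
      using \<open>k \<in> ?V\<close> that by (auto simp: fibre_funs_def)
    ultimately have "real (card (fibre_funs {1..?K} {1..N} k)) = ?C * (\<Prod>l\<in>{1..N}. ?p (k l))"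
      by (intro card_configs_with_occ assms(1)) auto
    then show ?thesis
      using fibre_funs_prod[OF _ _ that, of ?p] by simp
  qed
  then have "(\<Sum>k\<in>?V. ?C * (\<Prod>j\<in>?J. ?p j ^ n j)) =
      (\<Sum>k\<in>?V. real (card (fibre_funs {1..?K} {1..N} k)))"
    by (rule sum.cong[OF refl])
  then have "real (card ?V) * (?C * (\<Prod>j\<in>?J. ?p j ^ n j)) =
      (\<Sum>k\<in>?V. real (card (fibre_funs {1..?K} {1..N} k)))"
    by (simp only: sum_constant)
  \<comment> \<open>A configuration determines its occupation vector, so the sets are
    disjoint.\<close>
  also have "\<dots> = real (card (\<Union>k\<in>?V. fibre_funs {1..?K} {1..N} k))"
  proof -
    have "k = k'" if "k \<in> ?V" "k' \<in> ?V"
      "\<omega> \<in> fibre_funs {1..?K} {1..N} k" "\<omega> \<in> fibre_funs {1..?K} {1..N} k'" for k k' \<omega>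
    proof (rule PiE_ext)
      show "k \<in> {1..N} \<rightarrow>\<^sub>E ?J" "k' \<in> {1..N} \<rightarrow>\<^sub>E ?J"
        using that by (auto simp: fibre_funs_def)
      show "k l = k' l" if "l \<in> {1..N}" for l
        using that \<open>\<omega> \<in> fibre_funs _ _ k\<close> \<open>\<omega> \<in> fibre_funs _ _ k'\<close> by (simp add: fibre_funs_def)
    qed
    then have "fibre_funs {1..?K} {1..N} k \<inter> fibre_funs {1..?K} {1..N} k' = {}"
      if "k \<in> ?V" "k' \<in> ?V" "k \<noteq> k'" for k k' using that by blast
    then show ?thesis
      using finV by (subst card_UN_disjoint) (auto simp: finite_fibre_funs)
  qed
  also have "\<dots> \<le> real (card (restricted_configs b c m N))"
  proof -
    have "(\<Union>k\<in>?V. fibre_funs {1..?K} {1..N} k) \<subseteq> restricted_configs b c m N"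
    proof
      fix \<omega> assume "\<omega> \<in> (\<Union>k\<in>?V. fibre_funs {1..?K} {1..N} k)"
      then obtain k where k: "k \<in> ?V" "\<omega> \<in> fibre_funs {1..?K} {1..N} k" by blast
      then have \<omega>: "\<omega> \<in> configs c N" "\<And>l. l \<in> {1..N} \<Longrightarrow> occ c N \<omega> l = k l"
        unfolding configs_with_occ by auto
      have occJ: "occ c N \<omega> l \<in> ?J" if "l \<in> {1..N}" for l
        using \<omega>(2)[OF that] k that unfolding fibre_funs_def by (auto dest!: PiE_mem)
      have "j \<in> ?J" if "1 \<le> num_sites c N \<omega> j" for j
      proof -
        have "{l \<in> {1..N}. occ c N \<omega> l = j} \<noteq> {}"
          using that unfolding num_sites_def by (metis card.empty not_one_le_zero)
        then show ?thesis using occJ by blast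
      qed
      \<comment> \<open>Occupied classes lie in \<open>{b..M}\<close>, so the bound by
        \<open>m N\<close> reduces to the size of this interval.\<close>
      then have "num_classes b c N \<omega> \<le> card ?J"
        unfolding num_classes_def by (intro card_mono) auto
      then show "\<omega> \<in> restricted_configs b c m N"
        using \<omega>(1) occJ assms(4) by (auto simp: restricted_configs_def)
    qed
    then show ?thesis using finite_restricted_configs by (auto intro: card_mono)
  qed
  finally have "fact N / (\<Prod>j\<in>?J. fact (n j)) * (?C * (\<Prod>j\<in>?J. ?p j ^ n j))
      \<le> real (card (restricted_configs b c m N))"
    unfolding cardV .
  then show ?thesis by (subst mult.left_commute)
qed

section \<open>Type classes and their size\<close>

lemma occ_mem:
  assumes "\<omega> \<in> restricted_configs b c m N" "l \<in> {1..N}"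
  shows "occ c N \<omega> l \<in> {b..particles c N}"
proof -
  have "occ c N \<omega> l \<le> card {1..particles c N}"
    unfolding occ_def by (intro card_mono) auto
  then show ?thesis using assms by (simp add: restricted_configs_def)
qed

lemma occ_fibre_funs:
  assumes "\<omega> \<in> restricted_configs b c m N"
  shows "restrict (occ c N \<omega>) {1..N} \<in> fibre_funs {1..N} {b..particles c N} (num_sites c N \<omega>)"
proof -
  have "{a \<in> {1..N}. restrict (occ c N \<omega>) {1..N} a = y} = {a \<in> {1..N}. occ c N \<omega> a = y}" for y
    by auto
  then show ?thesis using occ_mem[OF assms] by (auto simp: fibre_funs_def num_sites_def)
qed

lemma num_sites_outside:
  assumes "\<omega> \<in> restricted_configs b c m N" "j \<notin> {b..particles c N}"
  shows "num_sites c N \<omega> j = 0"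
proof -
  have "{l \<in> {1..N}. occ c N \<omega> l = j} = {}" using occ_mem[OF assms(1)] assms(2) by auto
  then show ?thesis by (simp add: num_sites_def)
qed

lemma rel_entropy_Theta:
  assumes "0 < \<alpha>" "2 \<le> N" "\<omega> \<in> restricted_configs b c m N"
  shows "rel_entropy b (Theta b c N \<omega>) (rho b \<alpha>) =
    ereal (\<Sum>j\<in>{b..particles c N}. pmf (Theta b c N \<omega>) j * ln (pmf (Theta b c N \<omega>) j / pmf (rho b \<alpha>) j))"
proof -
  let ?\<theta> = "Theta b c N \<omega>"
  let ?f = "\<lambda>j. pmf ?\<theta> j * ln (pmf ?\<theta> j / pmf (rho b \<alpha>) j)"
  have "set_pmf ?\<theta> \<subseteq> set_pmf (rho b \<alpha>)"
    using Zb_pos[OF assms(1), of b] assms(1)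
    by (auto simp: set_pmf_iff pmf_Theta[OF assms(2,3)] pmf_rho split: if_splits)
  moreover have "(?f has_sum sum ?f {b..particles c N}) {b..}"
  proof (rule has_sum_finite_neutralI)
    show "?f j = 0" if "j \<in> {b..} - {b..particles c N}" for j
      using that num_sites_outside[OF assms(3), of j] by (simp add: pmf_Theta[OF assms(2,3)])
  qed auto
  ultimately show ?thesis
    by (auto simp: rel_entropy_def summable_on_def infsumI)
qed

text \<open>The method of types: on the vectors of one type the product of the \<rho>-masses equals
  exp(-N R) times the product of the \<theta>-masses, and the latter products sum to at most
  1.\<close>

lemma card_type_class_le:
  assumes "0 < \<alpha>" "2 \<le> N" "\<omega>\<^sub>0 \<in> restricted_configs b c m N"
    and y: "ereal y \<le> rel_entropy b (Theta b c N \<omega>\<^sub>0) (rho b \<alpha>)"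
  shows "real (card {\<omega> \<in> restricted_configs b c m N. Theta b c N \<omega> = Theta b c N \<omega>\<^sub>0})
    \<le> weight_const b \<alpha> N (particles c N) * exp (- (real N * y))"
proof -
  let ?K = "particles c N"
  let ?J = "{b..?K}"
  let ?C = "weight_const b \<alpha> N ?K"
  let ?n = "num_sites c N \<omega>\<^sub>0"
  let ?t = "pmf (Theta b c N \<omega>\<^sub>0)" and ?p = "pmf (rho b \<alpha>)"
  let ?V = "fibre_funs {1..N} ?J ?n"
  let ?W = "{k \<in> ?V. (\<Sum>l\<in>{1..N}. k l) = ?K}"
  let ?A = "{\<omega> \<in> restricted_configs b c m N. Theta b c N \<omega> = Theta b c N \<omega>\<^sub>0}"
  let ?R = "\<Sum>j\<in>?J. ?t j * ln (?t j / ?p j)"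
  have t: "?t j = real (?n j) / real N" if "b \<le> j" for j
    using pmf_Theta[OF assms(2,3)] that by simp
  have yR: "y \<le> ?R" using y by (simp add: rel_entropy_Theta[OF assms(1-3)])
  have "?A \<subseteq> (\<Union>k\<in>?W. fibre_funs {1..?K} {1..N} k)"
  proof
    fix \<omega> assume "\<omega> \<in> ?A"
    then have \<omega>: "\<omega> \<in> restricted_configs b c m N" "Theta b c N \<omega> = Theta b c N \<omega>\<^sub>0" by auto
    have "num_sites c N \<omega> j = ?n j" if "j \<in> ?J" for j
      using pmf_Theta[OF assms(2) \<omega>(1), of j] t[of j] that \<omega>(2) assms(2) by simp
    then have "restrict (occ c N \<omega>) {1..N} \<in> ?V"
      using occ_fibre_funs[OF \<omega>(1)] by (simp add: fibre_funs_def)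
    moreover have cf: "\<omega> \<in> configs c N" using \<omega>(1) by (simp add: restricted_configs_def)
    moreover have "(\<Sum>l\<in>{1..N}. restrict (occ c N \<omega>) {1..N} l) = ?K"
      using sum_occ[OF cf] by simp
    moreover have "\<omega> \<in> fibre_funs {1..?K} {1..N} (restrict (occ c N \<omega>) {1..N})"
      using cf unfolding configs_with_occ by simp
    ultimately show "\<omega> \<in> (\<Union>k\<in>?W. fibre_funs {1..?K} {1..N} k)"
      by blast
  qed
  then have "card ?A \<le> card (\<Union>k\<in>?W. fibre_funs {1..?K} {1..N} k)"
    by (intro card_mono) (auto simp: finite_fibre_funs)
  also have "\<dots> \<le> (\<Sum>k\<in>?W. card (fibre_funs {1..?K} {1..N} k))"
    by (intro card_UN_le) (simp add: finite_fibre_funs)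
  finally have "card ?A \<le> (\<Sum>k\<in>?W. card (fibre_funs {1..?K} {1..N} k))" .
  then have "real (card ?A) \<le> real (\<Sum>k\<in>?W. card (fibre_funs {1..?K} {1..N} k))"
    by (rule of_nat_mono)
  also have "\<dots> = (\<Sum>k\<in>?W. real (card (fibre_funs {1..?K} {1..N} k)))"
    by (rule of_nat_sum)
  also have "\<dots> = (\<Sum>k\<in>?W. ?C * (\<Prod>l\<in>{1..N}. ?p (k l)))"
    using assms(1) by (intro sum.cong refl card_configs_with_occ) (auto simp: fibre_funs_def dest!: PiE_mem)
  \<comment> \<open>The particle constraint was needed to count configurations; the terms are
    nonnegative, so it can now be dropped.\<close>
  also have "\<dots> \<le> (\<Sum>k\<in>?V. ?C * (\<Prod>l\<in>{1..N}. ?p (k l)))"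
    using weight_const_pos[OF assms(1), of b N ?K]
    by (intro sum_mono2) (auto simp: finite_fibre_funs prod_nonneg)
  also have "\<dots> = (\<Sum>k\<in>?V. ?C * (exp (- (real N * ?R)) * (\<Prod>l\<in>{1..N}. ?t (k l))))"
  proof (intro sum.cong refl)
    fix k assume k: "k \<in> ?V"
    have "?p j ^ ?n j = exp (- (real N * (?t j * ln (?t j / ?p j)))) * ?t j ^ ?n j" if "j \<in> ?J" for j
    \<comment> \<open>Empty classes contribute the factor 1 on both sides, by 0 log 0 = 0; taking
      logarithms needs positive masses.\<close>
    proof (cases "?n j = 0")
      case False
      then have pos: "0 < ?t j" "0 < ?p j"
        using that assms(1,2) Zb_pos[OF assms(1), of b] by (auto simp: t pmf_rho)
      have "real N * ?t j = real (?n j)" using that assms(2) by (simp add: t)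
      moreover have "ln (?t j / ?p j) = ln (?t j) - ln (?p j)"
        using pos by (simp add: ln_div)
      ultimately have ln_eq:
        "real N * (?t j * ln (?t j / ?p j)) = real (?n j) * (ln (?t j) - ln (?p j))"
        by (simp only: flip: mult.assoc)
      have pow_eq: "?p j ^ ?n j = exp (real (?n j) * ln (?p j))"
        "?t j ^ ?n j = exp (real (?n j) * ln (?t j))"
        using pos by (simp_all only: exp_of_nat_mult exp_ln)
      show ?thesis
        unfolding ln_eq pow_eq exp_add[symmetric] by (simp add: right_diff_distrib)
    qed (use that in \<open>simp add: t\<close>)
    then have "(\<Prod>j\<in>?J. ?p j ^ ?n j) =
      (\<Prod>j\<in>?J. exp (- (real N * (?t j * ln (?t j / ?p j))))) * (\<Prod>j\<in>?J. ?t j ^ ?n j)"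
      by (simp flip: prod.distrib)
    also have "(\<Prod>j\<in>?J. exp (- (real N * (?t j * ln (?t j / ?p j))))) = exp (- (real N * ?R))"
      by (simp add: sum_distrib_left sum_negf flip: exp_sum)
    finally have "(\<Prod>l\<in>{1..N}. ?p (k l)) = exp (- (real N * ?R)) * (\<Prod>l\<in>{1..N}. ?t (k l))"
      using fibre_funs_prod[OF _ _ k, of ?p] fibre_funs_prod[OF _ _ k, of ?t] by simp
    then show "?C * (\<Prod>l\<in>{1..N}. ?p (k l)) = ?C * (exp (- (real N * ?R)) * (\<Prod>l\<in>{1..N}. ?t (k l)))"
      by simp
  qed
  also have "\<dots> = ?C * exp (- (real N * ?R)) * (\<Sum>k\<in>?V. \<Prod>l\<in>{1..N}. ?t (k l))"
    by (simp add: sum_distrib_left mult.assoc)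
  \<comment> \<open>Passing to all vectors over \<open>?J\<close> makes the sum of products factor
    into N equal factors, each a probability.\<close>
  also have "(\<Sum>k\<in>?V. \<Prod>l\<in>{1..N}. ?t (k l)) \<le> (\<Sum>k\<in>{1..N} \<rightarrow>\<^sub>E ?J. \<Prod>l\<in>{1..N}. ?t (k l))"
    by (intro sum_mono2) (auto simp: finite_PiE fibre_funs_def prod_nonneg)
  also have "\<dots> = (\<Prod>l\<in>{1..N}. \<Sum>j\<in>?J. ?t j)"
    by (rule prod_sum_PiE[symmetric]) auto
  also have "\<dots> \<le> 1"
    by (auto intro!: power_le_one sum_nonneg simp: measure_measure_pmf_finite[symmetric])
  finally have "real (card ?A) \<le> ?C * exp (- (real N * ?R))"
    using weight_const_pos[OF assms(1), of b N ?K] by simp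
  also have "\<dots> \<le> ?C * exp (- (real N * y))"
    using mult_left_mono[OF yR, of "real N"] weight_const_pos[OF assms(1), of b N ?K] by simp
  finally show ?thesis .
qed

text \<open>Such a set is the range of a function on \<open>{1..r}\<close>: enumerate it and fill
  the remaining places with one of its elements, which is where nonemptiness enters.\<close>

lemma card_nonempty_subsets_le:
  assumes "finite U"
  shows "card {X. X \<subseteq> U \<and> X \<noteq> {} \<and> card X \<le> r} \<le> card U ^ r"
proof -
  have "{X. X \<subseteq> U \<and> X \<noteq> {} \<and> card X \<le> r} \<subseteq> (\<lambda>f. f ` {1..r}) ` ({1..r} \<rightarrow>\<^sub>E U)"
  proof
    fix X assume "X \<in> {X. X \<subseteq> U \<and> X \<noteq> {} \<and> card X \<le> r}"
    then have X: "X \<subseteq> U" "X \<noteq> {}" "card X \<le> r" by auto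
    have "finite X" using X assms finite_subset by blast
    then obtain h where h: "bij_betw h {1..card X} X"
      using ex_bij_betw_nat_finite_1 by blast
    obtain x where x: "x \<in> X" using X by blast
    define f where "f = restrict (\<lambda>i. if i \<le> card X then h i else x) {1..r}"
    have "f ` {1..r} = X"
    proof
      show "f ` {1..r} \<subseteq> X" using bij_betw_apply[OF h] x by (auto simp: f_def)
      show "X \<subseteq> f ` {1..r}"
      proof
        fix z assume "z \<in> X"
        then obtain i where i: "i \<in> {1..card X}" "z = h i" using h unfolding bij_betw_def by blast
        then have "z = f i" "i \<in> {1..r}" using X by (auto simp: f_def)
        then show "z \<in> f ` {1..r}" by blast
      qed
    qed
    moreover from this have "f \<in> {1..r} \<rightarrow>\<^sub>E U"
      using X unfolding PiE_def by (intro IntI funcsetI) (blast, simp add: f_def)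
    ultimately show "X \<in> (\<lambda>f. f ` {1..r}) ` ({1..r} \<rightarrow>\<^sub>E U)" by blast
  qed
  then have "card {X. X \<subseteq> U \<and> X \<noteq> {} \<and> card X \<le> r} \<le> card ({1..r} \<rightarrow>\<^sub>E U)"
    using assms by (intro surj_card_le) (auto simp: finite_PiE)
  then show ?thesis by (simp add: card_PiE)
qed

text \<open>The density measure can be recovered from the graph of \<open>num_sites\<close> on the
  occupied classes, a set of at most \<open>m N\<close> pairs from a box of (K + 1)(N + 1)
  points.\<close>

lemma card_Theta_image_le:
  assumes "2 \<le> N"
  shows "card (Theta b c N ` restricted_configs b c m N)
    \<le> ((particles c N + 1) * (N + 1)) ^ m N"
proof -
  let ?S = "restricted_configs b c m N" and ?K = "particles c N"
  define G where "G = (\<lambda>\<omega>. (\<lambda>j. (j, num_sites c N \<omega> j)) ` {j. b \<le> j \<and> 1 \<le> num_sites c N \<omega> j})"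
  \<comment> \<open>Decodes a graph into the weights of the measure; classes absent from the graph
    get weight 0.\<close>
  define T where "T = (\<lambda>(X :: (nat \<times> nat) set) j. if \<exists>v. (j, v) \<in> X then real (THE v. (j, v) \<in> X) / real N else 0)"
  have "Theta b c N \<omega> = embed_pmf (T (G \<omega>))" for \<omega>
  proof -
    have "T (G \<omega>) j = (if b \<le> j then real (num_sites c N \<omega> j) / real N else 0)" for j
    proof -
      have "(j, v) \<in> G \<omega> \<longleftrightarrow> b \<le> j \<and> 1 \<le> num_sites c N \<omega> j \<and> v = num_sites c N \<omega> j" for v
        by (auto simp: G_def)
      then show ?thesis by (auto simp: T_def)
    qed
    then show ?thesis unfolding Theta_def by presburger
  qed
  then have "Theta b c N ` ?S = (\<lambda>X. embed_pmf (T X)) ` G ` ?S"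
    by (simp add: image_image)
  then have "card (Theta b c N ` ?S) \<le> card (G ` ?S)"
    by (simp add: card_image_le finite_restricted_configs)
  also have "\<dots> \<le> card {X. X \<subseteq> {0..?K} \<times> {0..N} \<and> X \<noteq> {} \<and> card X \<le> m N}"
  proof (rule card_mono)
    show "finite {X. X \<subseteq> {0..?K} \<times> {0..N} \<and> X \<noteq> {} \<and> card X \<le> m N}"
      by (rule finite_subset[of _ "Pow ({0..?K} \<times> {0..N})"]) auto
    show "G ` ?S \<subseteq> {X. X \<subseteq> {0..?K} \<times> {0..N} \<and> X \<noteq> {} \<and> card X \<le> m N}"
    proof safe
      fix \<omega> assume \<omega>: "\<omega> \<in> ?S"
      have le: "num_sites c N \<omega> j \<le> N" for j
      proof -
        have "num_sites c N \<omega> j \<le> card {1..N}"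
          unfolding num_sites_def by (intro card_mono) auto
        then show ?thesis by simp
      qed
      have J: "{j. b \<le> j \<and> 1 \<le> num_sites c N \<omega> j} \<subseteq> {b..?K}"
        using num_sites_outside[OF \<omega>] by fastforce
      show "x \<in> {0..?K}" "y \<in> {0..N}" if "(x, y) \<in> G \<omega>" for x y
        using that J le by (auto simp: G_def)
      have "card (G \<omega>) \<le> num_classes b c N \<omega>"
        unfolding G_def num_classes_def using J finite_subset by (intro card_image_le) blast
      then show "card (G \<omega>) \<le> m N"
        using \<omega> by (simp add: restricted_configs_def)
      \<comment> \<open>The class containing site 1 is occupied, so the graph is not empty.\<close>
      have "occ c N \<omega> 1 \<in> {j. b \<le> j \<and> 1 \<le> num_sites c N \<omega> j}"
      proof -
        have "card {1 :: nat} \<le> num_sites c N \<omega> (occ c N \<omega> 1)"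
          unfolding num_sites_def using assms by (intro card_mono) auto
        then show ?thesis using occ_mem[OF \<omega>, of 1] assms by simp
      qed
      then show "G \<omega> = {} \<Longrightarrow> False" by (auto simp: G_def)
    qed
  qed
  also have "\<dots> \<le> ((?K + 1) * (N + 1)) ^ m N"
    using card_nonempty_subsets_le[of "{0..?K} \<times> {0..N}" "m N"] by simp
  finally show ?thesis .
qed

section \<open>Asymptotics of the normalising constant\<close>

lemma ln_fact_ge: "real n * ln (real n) - real n \<le> ln (fact n)"
proof (induction n)
  case (Suc n)
  have "real (Suc n) * ln (real (Suc n)) - real (Suc n)
      \<le> real n * ln (real n) - real n + ln (real (Suc n))"
  proof (cases "n = 0")
    case False
    have "ln (real (Suc n)) - ln (real n) = ln (1 + 1 / real n)"
      using False ln_div[of "real (Suc n)" "real n"] by (simp add: field_simps)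
    also have "\<dots> \<le> 1 / real n"
      by (rule ln_add_one_self_le_self) simp
    finally have "real n * (ln (real (Suc n)) - ln (real n)) \<le> 1"
      using False by (simp add: field_simps)
    then show ?thesis by (simp add: algebra_simps)
  qed simp
  then show ?case using Suc by (simp add: ln_mult del: of_nat_Suc)
qed simp

text \<open>Crude Stirling bounds suffice, since an error of order log N vanishes after division by
  N. The shift to n + 1 keeps the logarithm away from 0.\<close>

lemma ln_fact_le: "ln (fact n) \<le> (real n + 1) * ln (real n + 1) - real n"
proof (induction n)
  case (Suc n)
  let ?x = "real n + 1"
  have "- (1 / (?x + 1)) \<ge> ln (1 + - (1 / (?x + 1)))"
    by (rule ln_add_one_self_le_self2) simp
  also have "1 + - (1 / (?x + 1)) = ?x / (?x + 1)"
    by (simp add: field_simps)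
  also have "ln (?x / (?x + 1)) = ln ?x - ln (?x + 1)"
    by (subst ln_div) auto
  finally have "1 / (?x + 1) \<le> ln (?x + 1) - ln ?x" by simp
  then have "1 \<le> (?x + 1) * (ln (?x + 1) - ln ?x)"
    by (simp add: field_simps)
  moreover have "ln (fact (Suc n)) = ln ?x + ln (fact n)"
    by (simp add: ln_mult add.commute)
  ultimately show ?case using Suc by (simp add: algebra_simps)
qed simp

lemma filterlim_real_to_infinity: "filterlim real at_top (to_infinity c)"
  unfolding to_infinity_def
  by (rule filterlim_mono[OF filterlim_real_sequentially order_refl]) simp

lemma eventually_admissible: "\<forall>\<^sub>F N in to_infinity c. N \<in> admissible c"
  by (simp add: to_infinity_def eventually_inf_principal)

lemma inverse_real_tendsto_0: "((\<lambda>N. 1 / real N) \<longlongrightarrow> 0) (to_infinity c)"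
  using filterlim_real_to_infinity by (rule tendsto_divide_0[OF tendsto_const filterlim_at_top_imp_at_infinity])

text \<open>The multinomial probability of a type near \<theta> decays at a rate tending to at most
  the entropy of \<theta>; the strict inequality with \<eta> absorbs the Stirling errors.\<close>

lemma multinomial_weight_ge:
  fixes n :: "nat \<Rightarrow> nat \<Rightarrow> nat" and p \<theta> :: "nat \<Rightarrow> real"
  assumes fin: "finite J" and p: "\<And>j. j \<in> J \<Longrightarrow> 0 < p j" and \<theta>: "\<And>j. j \<in> J \<Longrightarrow> 0 < \<theta> j"
    and lim: "\<And>j. j \<in> J \<Longrightarrow> ((\<lambda>N. real (n N j) / real N) \<longlongrightarrow> \<theta> j) (to_infinity c)"
    and sum: "\<forall>\<^sub>F N in to_infinity c. sum (n N) J = N"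
    and \<eta>: "(\<Sum>j\<in>J. \<theta> j * ln (\<theta> j / p j)) < \<eta>"
  shows "\<forall>\<^sub>F N in to_infinity c.
    exp (- (real N * \<eta>)) \<le> fact N / (\<Prod>j\<in>J. fact (n N j)) * (\<Prod>j\<in>J. p j ^ n N j)"
proof -
  let ?F = "to_infinity c"
  let ?u = "\<lambda>N j. (real (n N j) + 1) / real N"
  \<comment> \<open>The Stirling exponent divided by -N. The last two terms are ln (n + 1) / N,
    split so that each part visibly tends to 0.\<close>
  let ?A = "\<lambda>N. \<Sum>j\<in>J. real (n N j) / real N * ln (?u N j / p j)
      + (ln (?u N j) * (1 / real N) + ln (real N) / real N)"
  have u: "((\<lambda>N. ?u N j) \<longlongrightarrow> \<theta> j) ?F" if "j \<in> J" for j
    using tendsto_add[OF lim[OF that] inverse_real_tendsto_0] by (simp add: add_divide_distrib)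
  have lnN: "((\<lambda>N. ln (real N) / real N) \<longlongrightarrow> 0) ?F"
    using filterlim_compose[OF ln_x_over_x_tendsto_0 filterlim_real_to_infinity] by simp
  have "(?A \<longlongrightarrow> (\<Sum>j\<in>J. \<theta> j * ln (\<theta> j / p j) + (ln (\<theta> j) * 0 + 0))) ?F"
  proof (intro tendsto_sum tendsto_add tendsto_mult lim lnN inverse_real_tendsto_0)
    fix j assume j: "j \<in> J"
    show "((\<lambda>N. ln (?u N j / p j)) \<longlongrightarrow> ln (\<theta> j / p j)) ?F"
      using p[OF j] \<theta>[OF j] by (intro tendsto_ln tendsto_divide u j tendsto_const) auto
    show "((\<lambda>N. ln (?u N j)) \<longlongrightarrow> ln (\<theta> j)) ?F"
      using \<theta>[OF j] by (intro tendsto_ln u j) auto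
  qed
  then have "\<forall>\<^sub>F N in ?F. ?A N < \<eta>"
    using \<eta> by (intro order_tendstoD) simp
  moreover have "\<forall>\<^sub>F N in ?F. 0 < N"
    using eventually_admissible by eventually_elim (auto simp: admissible_def)
  ultimately show ?thesis using sum
  proof eventually_elim
    fix N assume A: "?A N < \<eta>" and N: "0 < N" and sumN: "sum (n N) J = N"
    let ?W = "fact N / (\<Prod>j\<in>J. fact (n N j)) * (\<Prod>j\<in>J. p j ^ n N j)"
    have W: "0 < ?W" using p by (intro mult_pos_pos divide_pos_pos prod_pos) auto
    have "real N * ?A N = (\<Sum>j\<in>J. real N * (real (n N j) / real N * ln (?u N j / p j)
      + (ln (?u N j) * (1 / real N) + ln (real N) / real N)))"
      by (rule sum_distrib_left)
    also have "\<dots> = (\<Sum>j\<in>J. (real (n N j) + 1) * ln (real (n N j) + 1) - real (n N j)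
         - real (n N j) * ln (p j) - real (n N j) * (ln (real N) - 1))"
    proof (rule sum.cong[OF refl])
      fix j assume j: "j \<in> J"
      have lns: "ln (?u N j / p j) = ln (real (n N j) + 1) - ln (real N) - ln (p j)"
        "ln (?u N j) = ln (real (n N j) + 1) - ln (real N)"
        using N p[OF j] by (simp_all add: ln_div ln_mult)
      show "real N * (real (n N j) / real N * ln (?u N j / p j)
            + (ln (?u N j) * (1 / real N) + ln (real N) / real N))
        = (real (n N j) + 1) * ln (real (n N j) + 1) - real (n N j)
            - real (n N j) * ln (p j) - real (n N j) * (ln (real N) - 1)"
        unfolding lns using N by (simp add: field_simps)
    qed
    also have "\<dots> = (\<Sum>j\<in>J. (real (n N j) + 1) * ln (real (n N j) + 1) - real (n N j))
        - (\<Sum>j\<in>J. real (n N j) * ln (p j)) - real N * (ln (real N) - 1)"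
      using arg_cong[OF sumN, of real] by (simp add: sum_subtractf flip: sum_distrib_right)
    finally have NA: "real N * ?A N = \<dots>" .
    have "- (real N * \<eta>) \<le> - (real N * ?A N)"
      using A N by simp
    also have "\<dots> \<le> ln (fact N) - (\<Sum>j\<in>J. ln (fact (n N j))) + (\<Sum>j\<in>J. real (n N j) * ln (p j))"
      using ln_fact_ge[of N] sum_mono[of J "\<lambda>j. ln (fact (n N j))", OF ln_fact_le]
      unfolding NA by (simp add: algebra_simps)
    also have "\<dots> = ln ?W"
    proof -
      have "ln ?W = ln (fact N) - ln (\<Prod>j\<in>J. fact (n N j)) + ln (\<Prod>j\<in>J. p j ^ n N j)"
      proof -
        have "0 < (\<Prod>j\<in>J. fact (n N j) :: real)" "0 < (\<Prod>j\<in>J. p j ^ n N j)"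
          using p by (intro prod_pos; simp)+
        then show ?thesis
          by (subst ln_mult, simp, simp, subst ln_div, simp_all del: prod_eq_1_iff)
      qed
      moreover have "ln (\<Prod>j\<in>J. fact (n N j) :: real) = (\<Sum>j\<in>J. ln (fact (n N j)))"
        by (intro ln_prod) (use fin in auto)
      moreover have "ln (\<Prod>j\<in>J. p j ^ n N j) = (\<Sum>j\<in>J. ln (p j ^ n N j))"
        using fin by (intro ln_prod) (auto dest: p)
      moreover have "(\<Sum>j\<in>J. ln (p j ^ n N j)) = (\<Sum>j\<in>J. real (n N j) * ln (p j))"
        using p by (intro sum.cong) (simp_all add: ln_realpow)
      ultimately show ?thesis by simp
    qed
    finally show "exp (- (real N * \<eta>)) \<le> ?W"
      using W by (simp add: ln_ge_iff)
  qed
qed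


section \<open>A near-optimal type with exact totals\<close>

lemma rho_mean_excess_sums:
  assumes "0 < \<alpha>" "has_mean (rho b \<alpha>) c"
  shows "(\<lambda>j. (real j - real b) * pmf (rho b \<alpha>) j) sums (c - real b)"
proof -
  have "(\<lambda>j. pmf (rho b \<alpha>) j * real j - real b * pmf (rho b \<alpha>) j) sums (c - real b * 1)"
    using assms by (intro sums_diff sums_mult pmf_nat_sums) (simp add: has_mean_iff_sums)
  then show ?thesis by (simp add: algebra_simps)
qed

lemma sum_split_first_two:
  fixes f :: "nat \<Rightarrow> 'a :: comm_monoid_add"
  assumes "b + 2 \<le> M"
  shows "sum f {b..M} = f b + (f (b + 1) + sum f {b+2..M})"
  using assms by (simp add: sum.atLeast_Suc_atMost[of b] sum.atLeast_Suc_atMost[of "Suc b"])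

text \<open>Used with the masses and with the excess terms (j - b) \<open>p j\<close>. For the
  latter the limit is just \<open>p (b + 1)\<close>, as the term at \<open>b\<close>
  vanishes.\<close>

lemma tail_correction_tendsto:
  fixes f :: "nat \<Rightarrow> real"
  assumes "f sums s" "\<And>j. j < b \<Longrightarrow> f j = 0"
  shows "(\<lambda>M. s - sum f {b+2..M}) \<longlonglongrightarrow> f b + f (b + 1)"
proof -
  have "(\<lambda>M. s - (sum f {..M} - f b - f (b + 1))) \<longlonglongrightarrow> s - (s - f b - f (b + 1))"
    using assms(1) by (intro tendsto_diff tendsto_const) (simp add: sums_def_le)
  moreover have "\<forall>\<^sub>F M in sequentially. s - (sum f {..M} - f b - f (b + 1)) = s - sum f {b+2..M}"
    using eventually_ge_at_top[of "b + 2"]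
  proof eventually_elim
    case (elim M)
    have "sum f {..M} = sum f {b..M}"
      using assms(2) by (intro sum.mono_neutral_right) auto
    then show ?case using sum_split_first_two[OF elim, of f] by simp
  qed
  ultimately have "(\<lambda>M. s - sum f {b+2..M}) \<longlonglongrightarrow> s - (s - f b - f (b + 1))"
    by (rule Lim_transform_eventually)
  then show ?thesis by simp
qed

text \<open>The law \<open>rho b \<alpha>\<close> is approximated in entropy by laws of the same mean on \<open>{b..M}\<close> that
  agree with it above \<open>b + 1\<close>; the masses at \<open>b\<close> and \<open>b + 1\<close> restore the total mass and the mean.\<close>

lemma truncated_law_exists:
  fixes b :: nat and \<alpha> c \<eta> :: real
  assumes "0 < \<alpha>" "has_mean (rho b \<alpha>) c" "0 < \<eta>"
  defines "p \<equiv> pmf (rho b \<alpha>)"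
  obtains M \<theta>\<^sub>0 \<theta>\<^sub>1 where "b + 2 \<le> M" "0 < \<theta>\<^sub>0" "0 < \<theta>\<^sub>1"
    "\<theta>\<^sub>1 = c - real b - (\<Sum>j\<in>{b+2..M}. (real j - real b) * p j)"
    "\<theta>\<^sub>0 = 1 - \<theta>\<^sub>1 - (\<Sum>j\<in>{b+2..M}. p j)"
    "\<theta>\<^sub>0 * ln (\<theta>\<^sub>0 / p b) + \<theta>\<^sub>1 * ln (\<theta>\<^sub>1 / p (b + 1)) < \<eta>"
proof -
  \<comment> \<open>The mean equation in terms of the excess j - b involves only the mass at
    \<open>b + 1\<close> among the two free masses; normalisation then fixes the mass at
    \<open>b\<close>.\<close>
  define t1 where "t1 = (\<lambda>M. c - real b - (\<Sum>j\<in>{b+2..M}. (real j - real b) * p j))"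
  define t0 where "t0 = (\<lambda>M. 1 - t1 M - (\<Sum>j\<in>{b+2..M}. p j))"
  have pos: "0 < p b" "0 < p (b + 1)"
    using assms(1) Zb_pos[OF assms(1), of b] by (simp_all add: p_def pmf_rho)
  have zero: "p j = 0" if "j < b" for j using that assms(1) by (simp add: p_def pmf_rho)
  have t1: "t1 \<longlonglongrightarrow> p (b + 1)"
    using tail_correction_tendsto[OF rho_mean_excess_sums[OF assms(1,2)], of b] zero
    unfolding t1_def p_def by simp
  have "(\<lambda>M. (1 - (\<Sum>j\<in>{b+2..M}. p j)) - t1 M) \<longlonglongrightarrow> p b + p (b + 1) - p (b + 1)"
    using zero unfolding p_def
    by (intro tendsto_diff tail_correction_tendsto pmf_nat_sums t1[unfolded p_def]) auto
  then have t0: "t0 \<longlonglongrightarrow> p b" by (simp add: t0_def algebra_simps)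
  have "(\<lambda>M. t0 M * ln (t0 M / p b) + t1 M * ln (t1 M / p (b + 1)))
     \<longlonglongrightarrow> p b * ln (p b / p b) + p (b + 1) * ln (p (b + 1) / p (b + 1))"
    using pos by (intro tendsto_add tendsto_mult tendsto_ln tendsto_divide t0 t1 tendsto_const) auto
  then have "\<forall>\<^sub>F M in sequentially. t0 M * ln (t0 M / p b) + t1 M * ln (t1 M / p (b + 1)) < \<eta>"
    using pos assms(3) by (intro order_tendstoD) auto
  then have "\<forall>\<^sub>F M in sequentially. t0 M * ln (t0 M / p b) + t1 M * ln (t1 M / p (b + 1)) < \<eta>
      \<and> 0 < t0 M \<and> 0 < t1 M \<and> b + 2 \<le> M"
    using order_tendstoD(1)[OF t0 pos(1)] order_tendstoD(1)[OF t1 pos(2)]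
      eventually_ge_at_top[of "b + 2"] by eventually_elim auto
  then obtain M where "t0 M * ln (t0 M / p b) + t1 M * ln (t1 M / p (b + 1)) < \<eta>"
      "0 < t0 M" "0 < t1 M" "b + 2 \<le> M"
    using eventually_happens'[OF sequentially_bot] by blast
  with t0_def t1_def show thesis by (intro that[of M "t0 M" "t1 M"]) simp_all
qed

lemma real_particles:
  assumes "N \<in> admissible c" "0 \<le> c"
  shows "real (particles c N) = c * real N"
proof -
  obtain z where "c * real N = of_int z"
    using assms(1) by (auto simp: admissible_def elim: Ints_cases)
  moreover from this have "0 \<le> z"
    using assms(2) by (metis mult_nonneg_nonneg of_int_0_le_iff of_nat_0_le_iff)
  ultimately show ?thesis by (simp add: particles_def)
qed

lemma card_restricted_configs_asymp:
  fixes b :: nat and \<alpha> c \<eta> :: real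
  assumes "0 < \<alpha>" "real b < c" "has_mean (rho b \<alpha>) c" "0 < \<eta>"
    and m: "filterlim m at_top (to_infinity c)"
  shows "\<forall>\<^sub>F N in to_infinity c. weight_const b \<alpha> N (particles c N) * exp (- (real N * \<eta>))
    \<le> real (card (restricted_configs b c m N))"
proof -
  let ?F = "to_infinity c"
  define p where "p = pmf (rho b \<alpha>)"
  obtain M \<theta>\<^sub>0 \<theta>\<^sub>1 where M: "b + 2 \<le> M" and pos: "0 < \<theta>\<^sub>0" "0 < \<theta>\<^sub>1"
    and \<theta>\<^sub>1: "\<theta>\<^sub>1 = c - real b - (\<Sum>j\<in>{b+2..M}. (real j - real b) * p j)"
    and \<theta>\<^sub>0: "\<theta>\<^sub>0 = 1 - \<theta>\<^sub>1 - (\<Sum>j\<in>{b+2..M}. p j)"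
    and ent: "\<theta>\<^sub>0 * ln (\<theta>\<^sub>0 / p b) + \<theta>\<^sub>1 * ln (\<theta>\<^sub>1 / p (b + 1)) < \<eta>"
    by (rule truncated_law_exists[OF assms(1,3,4), folded p_def])
  have ppos: "0 < p j" if "b \<le> j" for j
    using that assms(1) Zb_pos[OF assms(1), of b] by (simp add: p_def pmf_rho)
  \<comment> \<open>Above \<open>b + 1\<close> the target counts are rounded down. The definitions
    of \<open>n1\<close> and \<open>n0\<close> then restore the exact particle and site
    totals.\<close>
  define q where "q = (\<lambda>N j. nat \<lfloor>real N * p j\<rfloor>)"
  define e where "e = (\<lambda>N. \<Sum>j\<in>{b+2..M}. (j - b) * q N j)"
  define n1 where "n1 = (\<lambda>N. particles c N - b * N - e N)"
  define n0 where "n0 = (\<lambda>N. N - n1 N - sum (q N) {b+2..M})"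
  define n where "n = (\<lambda>N j. if j = b then n0 N else if j = b + 1 then n1 N else q N j)"
  define \<theta> where "\<theta> = (\<lambda>j. if j = b then \<theta>\<^sub>0 else if j = b + 1 then \<theta>\<^sub>1 else p j)"
  have adm: "\<forall>\<^sub>F N in ?F. 0 < N \<and> real (particles c N) = c * real N"
    using eventually_admissible
    by eventually_elim (use assms(2) in \<open>auto simp: real_particles admissible_def\<close>)
  have q: "((\<lambda>N. real (q N j) / real N) \<longlongrightarrow> p j) ?F" if "b \<le> j" for j
  proof (rule tendsto_sandwich)
    show "((\<lambda>N. p j - 1 / real N) \<longlongrightarrow> p j) ?F"
      using tendsto_diff[OF tendsto_const[of "p j"] inverse_real_tendsto_0[of c]] by simp
    show "((\<lambda>N. p j) \<longlongrightarrow> p j) ?F" by simp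
    have eq: "real (q N j) = real_of_int \<lfloor>real N * p j\<rfloor>" for N
      using ppos[OF that] by (simp add: q_def)
    show "\<forall>\<^sub>F N in ?F. p j - 1 / real N \<le> real (q N j) / real N"
      using adm
    proof eventually_elim
      case (elim N)
      have "(real N * p j - 1) / real N \<le> real (q N j) / real N"
        unfolding eq by (intro divide_right_mono) (linarith, simp)
      then show ?case using elim by (simp add: diff_divide_distrib)
    qed
    show "\<forall>\<^sub>F N in ?F. real (q N j) / real N \<le> p j"
      using adm
    proof eventually_elim
      case (elim N)
      have "real (q N j) / real N \<le> real N * p j / real N"
        unfolding eq by (intro divide_right_mono) auto
      then show ?case using elim by simp
    qed
  qed
  have e_eq: "real (e N) / real N = (\<Sum>j\<in>{b+2..M}. (real j - real b) * (real (q N j) / real N))" for N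
    unfolding e_def of_nat_sum sum_divide_distrib by (intro sum.cong) (auto simp: of_nat_diff)
  \<comment> \<open>The positive limit \<open>\<theta>\<^sub>1\<close> ensures that the natural
    subtraction in \<open>n1\<close> is eventually exact; \<open>\<theta>\<^sub>0\<close> does the
    same for \<open>n0\<close> below.\<close>
  have "((\<lambda>N. c - real b - real (e N) / real N) \<longlongrightarrow> \<theta>\<^sub>1) ?F"
    unfolding \<theta>\<^sub>1 e_eq by (intro tendsto_diff tendsto_const tendsto_sum tendsto_mult q) auto
  moreover from this have "\<forall>\<^sub>F N in ?F. 0 < c - real b - real (e N) / real N"
    using pos by (intro order_tendstoD)
  with adm have n1_eq: "\<forall>\<^sub>F N in ?F. b * N + e N \<le> particles c N \<and>
      c - real b - real (e N) / real N = real (n1 N) / real N"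
  proof eventually_elim
    case (elim N)
    then have "0 < real N * (c - real b - real (e N) / real N)" by simp
    also have "\<dots> = real (particles c N) - real (b * N + e N)"
      using elim by (simp add: field_simps)
    finally have le: "b * N + e N \<le> particles c N" by linarith
    then have "real (n1 N) = real (particles c N) - real b * real N - real (e N)"
      by (simp add: n1_def of_nat_diff)
    then show ?case using le elim by (simp add: field_simps)
  qed
  ultimately have n1: "((\<lambda>N. real (n1 N) / real N) \<longlongrightarrow> \<theta>\<^sub>1) ?F"
    by (elim Lim_transform_eventually) (auto elim: eventually_mono)
  have "((\<lambda>N. 1 - real (n1 N) / real N - (\<Sum>j\<in>{b+2..M}. real (q N j) / real N)) \<longlongrightarrow> \<theta>\<^sub>0) ?F"
    unfolding \<theta>\<^sub>0 by (intro tendsto_diff tendsto_const tendsto_sum n1 q) auto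
  moreover from this have "\<forall>\<^sub>F N in ?F. 0 < 1 - real (n1 N) / real N - (\<Sum>j\<in>{b+2..M}. real (q N j) / real N)"
    using pos by (intro order_tendstoD)
  with adm have n0_eq: "\<forall>\<^sub>F N in ?F. n1 N + sum (q N) {b+2..M} \<le> N \<and>
      1 - real (n1 N) / real N - (\<Sum>j\<in>{b+2..M}. real (q N j) / real N) = real (n0 N) / real N"
  proof eventually_elim
    case (elim N)
    have s: "(\<Sum>j\<in>{b+2..M}. real (q N j) / real N) = real (sum (q N) {b+2..M}) / real N"
      by (simp add: sum_divide_distrib)
    have "0 < real N * (1 - real (n1 N) / real N - real (sum (q N) {b+2..M}) / real N)"
      using elim unfolding s by simp
    also have "\<dots> = real N - real (n1 N + sum (q N) {b+2..M})"
      using elim by (simp add: field_simps del: of_nat_sum)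
    finally have le: "n1 N + sum (q N) {b+2..M} \<le> N" by linarith
    then have r: "real (n0 N) = real N - real (n1 N) - real (sum (q N) {b+2..M})"
      by (simp add: n0_def of_nat_diff del: of_nat_sum)
    show ?case using le elim unfolding s r diff_divide_distrib by simp
  qed
  ultimately have n0: "((\<lambda>N. real (n0 N) / real N) \<longlongrightarrow> \<theta>\<^sub>0) ?F"
    by (elim Lim_transform_eventually) (auto elim: eventually_mono)
  have sums: "\<forall>\<^sub>F N in ?F. sum (n N) {b..M} = N \<and> (\<Sum>j\<in>{b..M}. n N j * j) = particles c N"
    using n0_eq n1_eq
  proof eventually_elim
    case (elim N)
    have N: "n0 N + (n1 N + sum (q N) {b+2..M}) = N" using elim by (simp add: n0_def)
    have K: "b * N + e N + n1 N = particles c N" using elim by (simp add: n1_def)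
    have "sum (n N) {b+2..M} = sum (q N) {b+2..M}"
      by (intro sum.cong) (auto simp: n_def)
    then have "sum (n N) {b..M} = N"
      unfolding sum_split_first_two[OF M] using N by (simp add: n_def)
    \<comment> \<open>Each occupation number is split as b + (j - b); \<open>e\<close> collects the
      second parts.\<close>
    moreover have "(\<Sum>j\<in>{b+2..M}. n N j * j) = b * sum (q N) {b+2..M} + e N"
      unfolding e_def sum_distrib_left sum.distrib[symmetric]
      by (intro sum.cong) (auto simp: n_def add_mult_distrib[symmetric] mult.commute)
    then have "(\<Sum>j\<in>{b..M}. n N j * j)
        = b * (n0 N + (n1 N + sum (q N) {b+2..M})) + e N + n1 N"
      unfolding sum_split_first_two[OF M] by (simp add: n_def algebra_simps)
    ultimately show ?case unfolding N K by simp
  qed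
  have "(\<Sum>j\<in>{b..M}. \<theta> j * ln (\<theta> j / p j)) =
      \<theta>\<^sub>0 * ln (\<theta>\<^sub>0 / p b) + (\<theta>\<^sub>1 * ln (\<theta>\<^sub>1 / p (b + 1)) + (\<Sum>j\<in>{b+2..M}. \<theta> j * ln (\<theta> j / p j)))"
    unfolding sum_split_first_two[OF M] by (simp add: \<theta>_def)
  also have "(\<Sum>j\<in>{b+2..M}. \<theta> j * ln (\<theta> j / p j)) = 0"
    by (intro sum.neutral) (auto simp: \<theta>_def)
  finally have "(\<Sum>j\<in>{b..M}. \<theta> j * ln (\<theta> j / p j)) < \<eta>" using ent by simp
  then have "\<forall>\<^sub>F N in ?F. exp (- (real N * \<eta>)) \<le>
      fact N / (\<Prod>j\<in>{b..M}. fact (n N j)) * (\<Prod>j\<in>{b..M}. p j ^ n N j)"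
  proof (intro multinomial_weight_ge)
    show "((\<lambda>N. real (n N j) / real N) \<longlongrightarrow> \<theta> j) ?F" if "j \<in> {b..M}" for j
      using that n0 n1 q[of j] by (simp add: n_def \<theta>_def)
    show "\<forall>\<^sub>F N in ?F. sum (n N) {b..M} = N" using sums by eventually_elim simp
  qed (use ppos pos in \<open>auto simp: \<theta>_def\<close>)
  moreover have "\<forall>\<^sub>F N in ?F. card {b..M} \<le> m N"
    using m by (simp add: filterlim_at_top)
  ultimately show ?thesis using sums
  proof eventually_elim
    case (elim N)
    then have "weight_const b \<alpha> N (particles c N) * exp (- (real N * \<eta>))
      \<le> weight_const b \<alpha> N (particles c N) *
        (fact N / (\<Prod>j\<in>{b..M}. fact (n N j)) * (\<Prod>j\<in>{b..M}. p j ^ n N j))"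
      using weight_const_pos[OF assms(1)] by (intro mult_left_mono) (auto simp: less_imp_le)
    also have "\<dots> \<le> real (card (restricted_configs b c m N))"
      unfolding p_def using elim by (intro card_restricted_configs_ge assms(1)) auto
    finally show ?case .
  qed
qed

section \<open>The large deviation bound\<close>

text \<open>All large multiples of a denominator of \<open>c\<close> are admissible. Without this,
  \<open>Lim\<close> along the filter would not be determined.\<close>

lemma to_infinity_neq_bot:
  assumes "c \<in> \<rat>"
  shows "to_infinity c \<noteq> bot"
proof
  assume "to_infinity c = bot"
  then have "\<forall>\<^sub>F N in to_infinity c. False" by simp
  then obtain N\<^sub>0 where N\<^sub>0: "\<And>N. N \<ge> N\<^sub>0 \<Longrightarrow> N \<notin> admissible c"
    by (auto simp: to_infinity_def eventually_inf_principal eventually_at_top_linorder)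
  obtain a d' :: int where d': "0 < d'" "c = of_int a / of_int d'"
    using assms by (elim Rats_cases') auto
  define d where "d = nat d'"
  have d: "d \<noteq> 0" "c = of_int a / of_nat d" using d' by (simp_all add: d_def)
  define N where "N = d * (N\<^sub>0 + 2)"
  have "1 * (N\<^sub>0 + 2) \<le> N" unfolding N_def using d by (intro mult_right_mono) auto
  then have "N\<^sub>0 \<le> N" "2 \<le> N" by auto
  moreover have "c * real d = of_int a" using d by simp
  then have "c * real N = of_int (a * int (N\<^sub>0 + 2))"
    unfolding N_def of_nat_mult of_int_mult of_int_of_nat_eq mult.assoc[symmetric] by (simp only:)
  then have "c * real N \<in> \<int>" by (metis Ints_of_int)
  ultimately show False using N\<^sub>0[of N] by (simp add: admissible_def)
qed

text \<open>The logarithm of the count over N is (m / sqrt N) times (log of the base / sqrt N), and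
  both factors tend to 0.\<close>

lemma num_types_subexponential:
  assumes "0 < c" "0 < \<delta>" "((\<lambda>N. (real (m N))\<^sup>2 / real N) \<longlongrightarrow> 0) (to_infinity c)"
  shows "\<forall>\<^sub>F N in to_infinity c. real (((particles c N + 1) * (N + 1)) ^ m N) \<le> exp (real N * \<delta>)"
proof -
  let ?F = "to_infinity c"
  let ?l = "\<lambda>x. ln ((c * x + 1) * (x + 1))"
  have "((\<lambda>x. ?l x / sqrt x) \<longlongrightarrow> 0) at_top" using assms(1) by real_asymp
  then have "((\<lambda>N. ?l (real N) / sqrt (real N)) \<longlongrightarrow> 0) ?F"
    by (rule filterlim_compose[OF _ filterlim_real_to_infinity])
  moreover have "((\<lambda>N. sqrt ((real (m N))\<^sup>2 / real N)) \<longlongrightarrow> sqrt 0) ?F"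
    using assms(3) by (rule tendsto_real_sqrt)
  ultimately have "((\<lambda>N. sqrt ((real (m N))\<^sup>2 / real N) * (?l (real N) / sqrt (real N))) \<longlongrightarrow> sqrt 0 * 0) ?F"
    by (intro tendsto_mult)
  then have "\<forall>\<^sub>F N in ?F. sqrt ((real (m N))\<^sup>2 / real N) * (?l (real N) / sqrt (real N)) < \<delta>"
    using assms(2) by (intro order_tendstoD) auto
  then show ?thesis using eventually_admissible
  proof eventually_elim
    case (elim N)
    have N: "0 < real N" using elim(2) by (simp add: admissible_def)
    have "sqrt ((real (m N))\<^sup>2 / real N) * (?l (real N) / sqrt (real N)) = real (m N) * ?l (real N) / real N"
      using N by (simp add: real_sqrt_divide)
    then have "real (m N) * ?l (real N) / real N < \<delta>" using elim(1) by (simp only:)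
    then have le: "real (m N) * ?l (real N) \<le> real N * \<delta>"
      using N by (simp only: pos_divide_less_eq mult.commute[of \<delta>])
    have pos: "0 < (c * real N + 1) * (real N + 1)"
      using assms(1) by (intro mult_pos_pos add_nonneg_pos) auto
    have "real (((particles c N + 1) * (N + 1)) ^ m N) = ((c * real N + 1) * (real N + 1)) ^ m N"
      using real_particles[OF elim(2)] assms(1)
      by (simp only: of_nat_power of_nat_mult of_nat_add of_nat_1 less_imp_le)
    also have "\<dots> = exp (real (m N) * ?l (real N))"
      using pos by (simp only: exp_of_nat_mult exp_ln)
    also have "\<dots> \<le> exp (real N * \<delta>)" using le by simp
    finally show ?case .
  qed
qed

lemma Theta_in_prob_mean:
  assumes "N \<in> admissible c" "0 \<le> c" "\<omega> \<in> restricted_configs b c m N"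
  shows "Theta b c N \<omega> \<in> prob_mean b c"
proof -
  have N: "2 \<le> N" using assms(1) by (simp add: admissible_def)
  let ?J = "{b..particles c N}"
  have "(\<Sum>j\<in>?J. num_sites c N \<omega> j * j) = (\<Sum>l\<in>{1..N}. restrict (occ c N \<omega>) {1..N} l)"
    using fibre_funs_sum[OF _ _ occ_fibre_funs[OF assms(3)], of "\<lambda>j. j"] by simp
  also have "\<dots> = particles c N"
    using sum_occ[of \<omega> c N] assms(3) by (simp add: restricted_configs_def)
  finally have "(\<Sum>j\<in>?J. real (num_sites c N \<omega> j) * real j) = c * real N"
    using real_particles[OF assms(1,2)] by (metis (no_types, lifting) of_nat_mult of_nat_sum sum.cong)
  then have "(\<Sum>j\<in>?J. pmf (Theta b c N \<omega>) j * real j) = c"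
    using N by (simp add: pmf_Theta[OF N assms(3)] flip: sum_divide_distrib)
  moreover have "(\<lambda>j. pmf (Theta b c N \<omega>) j * real j) sums (\<Sum>j\<in>?J. pmf (Theta b c N \<omega>) j * real j)"
    using num_sites_outside[OF assms(3)] by (intro sums_finite) (auto simp: pmf_Theta[OF N assms(3)])
  moreover have "set_pmf (Theta b c N \<omega>) \<subseteq> {b..}"
    by (auto simp: set_pmf_iff pmf_Theta[OF N assms(3)] split: if_splits)
  ultimately show ?thesis by (simp add: prob_mean_def prob_on_def has_mean_iff_sums)
qed

text \<open>Number of types times the largest type class; every bad type has entropy at least
  \<open>x_star\<close>.\<close>

lemma card_bad_configs_le:
  assumes "0 < alpha b c" "real b < c" "2 \<le> N" "ereal y < x_star b c \<epsilon>"
  shows "real (card (restricted_configs b c m N \<inter>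
      {\<omega>. Theta b c N \<omega> \<in> prob_mean b c - prohorov_ball b c (rho b (alpha b c)) \<epsilon>}))
    \<le> real (((particles c N + 1) * (N + 1)) ^ m N)
      * (weight_const b (alpha b c) N (particles c N) * exp (- (real N * y)))"
    (is "real (card (?S \<inter> {\<omega>. _ \<in> ?Bad})) \<le> ?T * ?E")
proof -
  let ?A = "?S \<inter> {\<omega>. Theta b c N \<omega> \<in> ?Bad}"
  have fin: "finite ?A" using finite_restricted_configs by blast
  have class_le: "real (card {\<omega> \<in> ?A. Theta b c N \<omega> = \<theta>}) \<le> ?E" if "\<theta> \<in> Theta b c N ` ?A" for \<theta>
  proof -
    obtain \<omega>\<^sub>0 where \<omega>\<^sub>0: "\<omega>\<^sub>0 \<in> ?S" "\<theta> = Theta b c N \<omega>\<^sub>0" and bad: "\<theta> \<in> ?Bad"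
      using \<open>\<theta> \<in> Theta b c N ` ?A\<close> by blast
    \<comment> \<open>The mean \<open>c\<close> belongs to [b, c], so a measure outside the ball is
      also outside the larger ball over which \<open>x_star\<close> is taken.\<close>
    have "\<theta> \<in> prob_mean_upto b c - prohorov_ball_hat b c (rho b (alpha b c)) \<epsilon>"
      using bad assms(2)
      by (auto simp: prob_mean_def prob_mean_upto_def prohorov_ball_def prohorov_ball_hat_def)
    then have "x_star b c \<epsilon> \<le> rel_entropy b \<theta> (rho b (alpha b c))"
      unfolding x_star_def by (rule INF_lower)
    then have "ereal y \<le> rel_entropy b (Theta b c N \<omega>\<^sub>0) (rho b (alpha b c))"
      using assms(4) \<omega>\<^sub>0 by simp
    note le = card_type_class_le[OF assms(1,3) \<omega>\<^sub>0(1) this]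
    have "card {\<omega> \<in> ?A. Theta b c N \<omega> = \<theta>} \<le> card {\<omega> \<in> ?S. Theta b c N \<omega> = Theta b c N \<omega>\<^sub>0}"
      using \<omega>\<^sub>0(2) by (intro card_mono) (auto simp: finite_restricted_configs)
    with le show ?thesis by linarith
  qed
  have "real (card ?A) = (\<Sum>\<theta>\<in>Theta b c N ` ?A. real (card {\<omega> \<in> ?A. Theta b c N \<omega> = \<theta>}))"
    using sum.image_gen[OF fin, of "\<lambda>_. 1 :: nat" "Theta b c N"] by simp
  also have "\<dots> \<le> (\<Sum>\<theta>\<in>Theta b c N ` ?A. ?E)"
    by (rule sum_mono[OF class_le])
  also have "\<dots> = real (card (Theta b c N ` ?A)) * ?E" by simp
  also have "\<dots> \<le> ?T * ?E"
  proof (rule mult_right_mono)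
    have "card (Theta b c N ` ?A) \<le> card (Theta b c N ` ?S)"
      by (intro card_mono) (auto simp: finite_restricted_configs)
    also have "\<dots> \<le> ((particles c N + 1) * (N + 1)) ^ m N"
      using assms(3) by (rule card_Theta_image_le)
    finally show "real (card (Theta b c N ` ?A)) \<le> ?T" by (rule of_nat_mono)
    show "0 \<le> ?E" using weight_const_pos[OF assms(1)] by (simp add: less_imp_le)
  qed
  finally show ?thesis .
qed

text \<open>Needed because \<open>pmf_of_set\<close> is unspecified on the empty set.\<close>

lemma restricted_configs_nonempty:
  assumes "real b < c" "filterlim m at_top (to_infinity c)"
  shows "\<forall>\<^sub>F N in to_infinity c. restricted_configs b c m N \<noteq> {}"
  using card_restricted_configs_asymp[OF alpha_props(1)[OF assms(1)] assms(1)
      alpha_props(2)[OF assms(1)] zero_less_one assms(2)]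
proof eventually_elim
  case (elim N)
  then have "0 < real (card (restricted_configs b c m N))"
    using weight_const_pos[OF alpha_props(1)[OF assms(1)], of b N "particles c N"]
    by (smt (verit) exp_gt_zero mult_pos_pos)
  then show ?case by auto
qed

lemma prob_bad_le:
  assumes c: "real b < c" and m: "filterlim m at_top (to_infinity c)"
    and m2: "((\<lambda>N. (real (m N))\<^sup>2 / real N) \<longlongrightarrow> 0) (to_infinity c)"
    and y: "ereal y < x_star b c \<epsilon>"
  shows "\<forall>\<^sub>F N in to_infinity c. measure_pmf.prob (unif b c m N)
      {\<omega>. Theta b c N \<omega> \<in> prob_mean b c - prohorov_ball b c (rho b (alpha b c)) \<epsilon>}
    \<le> exp (- (real N * y))"
proof -
  obtain y' where y': "ereal y < ereal y'" "ereal y' < x_star b c \<epsilon>"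
    using ereal_dense2[OF y] by blast
  \<comment> \<open>The slack y' - y is spent in equal halves, on the number of types and on the
    normalising constant.\<close>
  define \<delta> where "\<delta> = (y' - y) / 2"
  have \<delta>: "0 < \<delta>" using y' by (simp add: \<delta>_def)
  have c0: "0 < c" using c by linarith
  note alpha = alpha_props[OF c]
  from card_restricted_configs_asymp[OF alpha(1) c alpha(2) \<delta> m]
    num_types_subexponential[OF c0 \<delta> m2] eventually_admissible restricted_configs_nonempty[OF c m]
  show ?thesis
  proof eventually_elim
    case (elim N)
    let ?S = "restricted_configs b c m N"
    let ?B = "{\<omega>. Theta b c N \<omega> \<in> prob_mean b c - prohorov_ball b c (rho b (alpha b c)) \<epsilon>}"
    let ?W = "weight_const b (alpha b c) N (particles c N)"
    have W: "0 < ?W" by (rule weight_const_pos[OF alpha(1)])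
    have N: "2 \<le> N" using elim(3) by (simp add: admissible_def)
    have "measure_pmf.prob (unif b c m N) ?B = real (card (?S \<inter> ?B)) / real (card ?S)"
      unfolding unif_def using elim(4) finite_restricted_configs by (intro measure_pmf_of_set)
    also have "\<dots> \<le> (exp (real N * \<delta>) * (?W * exp (- (real N * y')))) / (?W * exp (- (real N * \<delta>)))"
    proof (rule frac_le)
      show "real (card (?S \<inter> ?B)) \<le> exp (real N * \<delta>) * (?W * exp (- (real N * y')))"
        using card_bad_configs_le[OF alpha(1) c N y'(2), of m] mult_right_mono[OF elim(2)] W
        by (meson exp_ge_zero less_imp_le mult_nonneg_nonneg order_trans)
    qed (use W elim(1) in simp_all)
    also have "\<dots> = exp (real N * \<delta>) * exp (- (real N * y')) / exp (- (real N * \<delta>))"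
      using W by simp
    also have "\<dots> = exp (real N * \<delta> + - (real N * y') - - (real N * \<delta>))"
      by (simp only: exp_add exp_diff)
    also have "real N * \<delta> + - (real N * y') - - (real N * \<delta>) = - (real N * y)"
      by (simp add: \<delta>_def field_simps)
    finally show ?case .
  qed
qed

text \<open>Every configuration in the support has a density measure of mean \<open>c\<close>, so
  the two events are complementary there.\<close>

lemma prob_good_eq:
  assumes "N \<in> admissible c" "0 \<le> c" "restricted_configs b c m N \<noteq> {}"
  shows "measure_pmf.prob (unif b c m N) {\<omega>. Theta b c N \<omega> \<in> prohorov_ball b c \<rho> \<epsilon>}
    = 1 - measure_pmf.prob (unif b c m N) {\<omega>. Theta b c N \<omega> \<in> prob_mean b c - prohorov_ball b c \<rho> \<epsilon>}"
proof -
  let ?P = "measure_pmf.prob (unif b c m N)"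
  let ?G = "{\<omega>. Theta b c N \<omega> \<in> prohorov_ball b c \<rho> \<epsilon>}"
  let ?B = "{\<omega>. Theta b c N \<omega> \<in> prob_mean b c - prohorov_ball b c \<rho> \<epsilon>}"
  have S: "set_pmf (unif b c m N) = restricted_configs b c m N"
    unfolding unif_def using assms(3) finite_restricted_configs by (rule set_pmf_of_set)
  have "?G \<inter> set_pmf (unif b c m N) = (- ?B) \<inter> set_pmf (unif b c m N)"
    using Theta_in_prob_mean[OF assms(1,2)] by (auto simp: S)
  then have "?P ?G = ?P (- ?B)"
    by (metis measure_Int_set_pmf)
  then show ?thesis
    using measure_pmf.prob_compl[of ?B "unif b c m N"] by (simp add: Compl_eq_Diff_UNIV)
qed

lemma prob_good_tendsto:
  assumes c: "real b < c" and m: "filterlim m at_top (to_infinity c)"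
    and m2: "((\<lambda>N. (real (m N))\<^sup>2 / real N) \<longlongrightarrow> 0) (to_infinity c)"
    and "0 < \<epsilon>"
  shows "((\<lambda>N. measure_pmf.prob (unif b c m N)
      {\<omega>. Theta b c N \<omega> \<in> prohorov_ball b c (rho b (alpha b c)) \<epsilon>}) \<longlongrightarrow> 1) (to_infinity c)"
proof -
  let ?F = "to_infinity c"
  let ?bad = "\<lambda>N. measure_pmf.prob (unif b c m N)
      {\<omega>. Theta b c N \<omega> \<in> prob_mean b c - prohorov_ball b c (rho b (alpha b c)) \<epsilon>}"
  \<comment> \<open>The rate \<open>x_star\<close> may be infinite, so a finite one is chosen below
    it.\<close>
  obtain y where y: "0 < y" "ereal y < x_star b c \<epsilon>"
    using ereal_dense2[OF x_star_pos[OF alpha_props(1)[OF c] assms(4)]] by auto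
  have "(?bad \<longlongrightarrow> 0) ?F"
  proof (rule tendsto_sandwich[of "\<lambda>_. 0"])
    show "\<forall>\<^sub>F N in ?F. ?bad N \<le> exp (- (real N * y))" by (rule prob_bad_le[OF c m m2 y(2)])
    have "((\<lambda>x. exp (- (x * y))) \<longlongrightarrow> 0) at_top" using y(1) by real_asymp
    then show "((\<lambda>N. exp (- (real N * y))) \<longlongrightarrow> 0) ?F"
      by (rule filterlim_compose[OF _ filterlim_real_to_infinity])
  qed simp_all
  then have "((\<lambda>N. 1 - ?bad N) \<longlongrightarrow> 1 - 0) ?F" by (intro tendsto_diff tendsto_const)
  then have "((\<lambda>N. 1 - ?bad N) \<longlongrightarrow> 1) ?F" by simp
  moreover have "\<forall>\<^sub>F N in ?F. 1 - ?bad N = measure_pmf.prob (unif b c m N)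
      {\<omega>. Theta b c N \<omega> \<in> prohorov_ball b c (rho b (alpha b c)) \<epsilon>}"
    using eventually_admissible restricted_configs_nonempty[OF c m]
    by eventually_elim (use c in \<open>simp add: prob_good_eq\<close>)
  ultimately show ?thesis by (rule Lim_transform_eventually)
qed

theorem theorem2p2:
  fixes b :: nat and c :: real and m :: "nat \<Rightarrow> nat"
  assumes "c \<in> \<rat>" and "real b < c"
    and "\<And>N. N \<in> admissible c \<Longrightarrow> 2 \<le> m N \<and> m N \<le> N"
    and "filterlim m at_top (to_infinity c)"
    and "((\<lambda>N. (real (m N))\<^sup>2 / real N) \<longlongrightarrow> 0) (to_infinity c)"
  shows "(\<forall>\<epsilon>>0.
            0 < x_star b c \<epsilon>
          \<and> (\<forall>y::real. 0 < y \<and> ereal y < x_star b c \<epsilon> \<longrightarrow>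
               (\<forall>\<^sub>F N in to_infinity c.
                  measure_pmf.prob (unif b c m N)
                    {\<omega>. Theta b c N \<omega> \<in>
                       prob_mean b c - prohorov_ball b c (rho b (alpha b c)) \<epsilon>}
                  \<le> exp (- (real N * y))))
          \<and> ((\<lambda>N. measure_pmf.prob (unif b c m N)
                {\<omega>. Theta b c N \<omega> \<in> prohorov_ball b c (rho b (alpha b c)) \<epsilon>})
               \<longlongrightarrow> 1) (to_infinity c))
       \<and> ((\<lambda>\<epsilon>. Lim (to_infinity c) (\<lambda>N. measure_pmf.prob (unif b c m N)
              {\<omega>. Theta b c N \<omega> \<in> prohorov_ball b c (rho b (alpha b c)) \<epsilon>}))
            \<longlongrightarrow> 1) (at_right 0)"
proof (intro conjI allI impI)
  fix \<epsilon> :: real assume \<epsilon>: "0 < \<epsilon>"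
  show "0 < x_star b c \<epsilon>" by (rule x_star_pos[OF alpha_props(1)[OF assms(2)] \<epsilon>])
  show "((\<lambda>N. measure_pmf.prob (unif b c m N)
      {\<omega>. Theta b c N \<omega> \<in> prohorov_ball b c (rho b (alpha b c)) \<epsilon>}) \<longlongrightarrow> 1) (to_infinity c)"
    by (rule prob_good_tendsto[OF assms(2,4,5) \<epsilon>])
  fix y :: real assume "0 < y \<and> ereal y < x_star b c \<epsilon>"
  then show "\<forall>\<^sub>F N in to_infinity c. measure_pmf.prob (unif b c m N)
      {\<omega>. Theta b c N \<omega> \<in> prob_mean b c - prohorov_ball b c (rho b (alpha b c)) \<epsilon>}
      \<le> exp (- (real N * y))"
    by (intro prob_bad_le[OF assms(2,4,5)]) simp
next
  have "Lim (to_infinity c) (\<lambda>N. measure_pmf.prob (unif b c m N)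
      {\<omega>. Theta b c N \<omega> \<in> prohorov_ball b c (rho b (alpha b c)) \<epsilon>}) = 1" if "0 < \<epsilon>" for \<epsilon>
    using to_infinity_neq_bot[OF assms(1)] prob_good_tendsto[OF assms(2,4,5) that]
    by (rule tendsto_Lim)
  then show "((\<lambda>\<epsilon>. Lim (to_infinity c) (\<lambda>N. measure_pmf.prob (unif b c m N)
      {\<omega>. Theta b c N \<omega> \<in> prohorov_ball b c (rho b (alpha b c)) \<epsilon>})) \<longlongrightarrow> 1) (at_right 0)"
    \<comment> \<open>The inner limit equals 1 for every positive \<epsilon>, so the outer function
      is constant to the right of 0.\<close>
    by (intro tendsto_eventually) (auto simp: eventually_at_filter)
qed

end
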